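(* Assume the modular curve $X(\Gamma)$ of $\Gamma=N+S$ has genus $g$ and $i\infty$ is not a Weierstrass point of $X(\Gamma)$. For $\tau_1,\tau_2\in\mathbb H$ and $q_2=e^{2\pi i\tau_2}$, $$\sum_{n=0}^\infty f_{\Gamma,n}(\tau_1)q_2^n=-\frac1{2\pi i}\,\frac{f'_{\Gamma,g+1}(\tau_2)}{f_{\Gamma,g+1}(\tau_2)-f_{\Gamma,g+1}(\tau_1)}+\frac{A(\tau_1,\tau_2)}{f_{\Gamma,g+1}(\tau_2)-f_{\Gamma,g+1}(\tau_1)},$$ where $$A(\tau_1,\tau_2)=\sum_{\ell=-g}^{g+1}(1-\ell)\,a_\Gamma(g+1,-\ell)\,h_{\Gamma,\ell}(\tau_2)+\sum_{\ell=1}^g f_{\Gamma,\ell+g+1}(\tau_1)\,h_{\Gamma,-\ell}(\tau_2)+\sum_{j=g+1}^{2g}\sum_{\ell=j-g}^{g}a_\Gamma(g+1,\ell-j)\,f_{\Gamma,j}(\tau_1)\,h_{\Gamma,-\ell}(\tau_2).$$ The left-hand side is understood as a $q_2$-expansion: for each fixed $\tau_1$ the identity holds for $\mathrm{Im}(\tau_2)$ sufficiently large, and the right-hand side is its meromorphic continuation in $\tau_2$.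
   Context: For a positive integer $N$ and a set $S$ of exact divisors $Q$ of $N$ ($Q\mid N$, $\gcd(Q,N/Q)=1$), $\Gamma=N+S$ is the subgroup of $\mathrm{PSL}_2(\mathbb R)$ generated by $\Gamma_0(N)$ and the Atkin-Lehner involutions $W_{Q,N}=\begin{pmatrix}Qx&y\\ Nz&Qw\end{pmatrix}$ ($x,y,z,w\in\mathbb Z$, determinant $Q$), $Q\in S$. $X(\Gamma)$ is the compactified modular curve $\Gamma\backslash(\mathbb H\cup\mathbb Q\cup\{i\infty\})$; $q=e^{2\pi i\tau}$. $M_0^{!,\infty}(\Gamma)$ is the space of weakly holomorphic modular functions on $\Gamma$ whose poles are supported only at $i\infty$ and which are holomorphic at the other cusps; $S_2^{!,\infty}(\Gamma)$ is the space of weight $2$ weakly holomorphic modular forms on $\Gamma$ whose poles are supported only at $i\infty$ and which vanish at the other cusps. Since $i\infty$ is not a Weierstrass point, for each $m\ge g+1$ there is a unique $f_{\Gamma,m}=q^{-m}+\sum_{l=1}^g a_\Gamma(m,-l)q^{-l}+\sum_{n\ge1}a_\Gamma(m,n)q^n\in M_0^{!,\infty}(\Gamma)$ (zero constant term); put $f_{\Gamma,0}=1$ and $f_{\Gamma,m}=0$ for $1\le m\le g$. For each integer $n\ge -g$, $n\ne0$, there is a unique $h_{\Gamma,n}=q^{-n}+\sum_{m\ge g+1}b_\Gamma(n,m)q^m\in S_2^{!,\infty}(\Gamma)$. Conventions: $a_\Gamma(g+1,-g-1)=1$ and $a_\Gamma(g+1,0)=0$, so the $\ell=0$ term of the first sum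 in $A$ is $0$. $f'$ denotes $df/d\tau$. *)

theory Defs
  imports "HOL-Complex_Analysis.Complex_Analysis" "HOL-Homology.Homology"
    "HOL-Algebra.Free_Abelian_Groups"
begin

section \<open>The groups N + S\<close>

abbreviation upper_half_plane :: "complex set" where
  "upper_half_plane \<equiv> {\<tau>. Im \<tau> > 0}"

definition SL2R :: "(real^2^2) monoid" where
  "SL2R = \<lparr>carrier = {A. det A = 1}, monoid.mult = (**), one = mat 1\<rparr>"

lemma group_SL2R: "group SL2R"
proof (rule groupI)
  fix A assume "A \<in> carrier SL2R"
  then have A: "det A = 1" by (simp add: SL2R_def)
  then obtain B where B: "B ** A = mat 1"
    by (metis invertible_def invertible_det_nz zero_neq_one)
  then have "det B = 1" using A by (metis det_I det_mul mult.right_neutral)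
  with B show "\<exists>B\<in>carrier SL2R. B \<otimes>\<^bsub>SL2R\<^esub> A = \<one>\<^bsub>SL2R\<^esub>"
    by (auto simp: SL2R_def)
qed (auto simp: SL2R_def det_mul matrix_mul_assoc)

definition SL2Z :: "(real^2^2) set" where
  "SL2Z = {A. det A = 1 \<and> (\<forall>i j. A $ i $ j \<in> \<int>)}"

definition Gamma0 :: "nat \<Rightarrow> (real^2^2) set" where
  "Gamma0 N = {A \<in> SL2Z. \<exists>k::int. A $ 2 $ 1 = of_int (int N * k)}"

definition exact_divisors :: "nat \<Rightarrow> nat set" where
  "exact_divisors N = {Q. Q dvd N \<and> coprime Q (N div Q)}"

text \<open>Matrices of determinant Q are scaled by the inverse square root of Q, so that they
  represent the same element of the projective group by a matrix of determinant one.\<close>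

definition atkin_lehner :: "nat \<Rightarrow> nat \<Rightarrow> (real^2^2) set" where
  "atkin_lehner Q N = {(1 / sqrt (real Q)) *\<^sub>R
       vector [vector [of_int (int Q * x), of_int y], vector [of_int (int N * z), of_int (int Q * w)]]
     | x y z w :: int. (int Q * x) * (int Q * w) - y * (int N * z) = int Q}"

text \<open>A subgroup of the projective group is represented by its full preimage in the special
  linear group; minus the identity already belongs to the group generated here, since it
  belongs to \<open>Gamma0 N\<close>.\<close>

definition Gamma_plus :: "nat \<Rightarrow> nat set \<Rightarrow> (real^2^2) set" where
  "Gamma_plus N S = generate SL2R (Gamma0 N \<union> (\<Union>Q\<in>S. atkin_lehner Q N))"

definition moebius_mat :: "real^2^2 \<Rightarrow> complex \<Rightarrow> complex" where
  "moebius_mat A \<tau> = (of_real (A $ 1 $ 1) * \<tau> + of_real (A $ 1 $ 2)) /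
                     (of_real (A $ 2 $ 1) * \<tau> + of_real (A $ 2 $ 2))"

text \<open>The action on the complex projective line, where \<open>None\<close> is the point at infinity.\<close>

fun moebius_ext :: "real^2^2 \<Rightarrow> complex option \<Rightarrow> complex option" where
  "moebius_ext A None =
     (if A $ 2 $ 1 = 0 then None else Some (of_real (A $ 1 $ 1 / A $ 2 $ 1)))"
| "moebius_ext A (Some z) =
     (if of_real (A $ 2 $ 1) * z + of_real (A $ 2 $ 2) = 0 then None
      else Some (moebius_mat A z))"


section \<open>The compactified modular curve and its genus\<close>

definition extended_plane :: "complex option set" where
  "extended_plane = Some ` upper_half_plane \<union> Some ` of_rat ` UNIV \<union> {None}"

text \<open>The usual topology: neighbourhoods of infinity contain a half-plane, neighbourhoods of a
  rational cusp contain an open disc tangent to the real line at that cusp.\<close>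

definition open_extended :: "complex option set \<Rightarrow> bool" where
  "open_extended U \<longleftrightarrow> U \<subseteq> extended_plane
     \<and> open {\<tau> \<in> upper_half_plane. Some \<tau> \<in> U}
     \<and> (None \<in> U \<longrightarrow> (\<exists>R>0. \<forall>\<tau>. Im \<tau> > R \<longrightarrow> Some \<tau> \<in> U))
     \<and> (\<forall>x::rat. Some (of_rat x) \<in> U \<longrightarrow>
          (\<exists>r>0. \<forall>\<tau>\<in>ball (Complex (of_rat x) r) r. Some \<tau> \<in> U))"

definition orbit_rel :: "(real^2^2) set \<Rightarrow> (complex option \<times> complex option) set" where
  "orbit_rel \<Gamma> = {(x, y). x \<in> extended_plane \<and> (\<exists>\<gamma>\<in>\<Gamma>. y = moebius_ext \<gamma> x)}"

definition modular_curve :: "(real^2^2) set \<Rightarrow> complex option set topology" where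
  "modular_curve \<Gamma> = topology (\<lambda>V. V \<subseteq> extended_plane // orbit_rel \<Gamma>
     \<and> open_extended {x \<in> extended_plane. orbit_rel \<Gamma> `` {x} \<in> V})"

lemma istopology_open_extended: "istopology open_extended"
  unfolding istopology_def
proof (intro conjI allI impI)
  fix U V assume U: "open_extended U" and V: "open_extended V"
  have eq: "{\<tau> \<in> upper_half_plane. Some \<tau> \<in> U \<inter> V} =
      {\<tau> \<in> upper_half_plane. Some \<tau> \<in> U} \<inter> {\<tau> \<in> upper_half_plane. Some \<tau> \<in> V}" by auto
  have 1: "\<exists>R>0. \<forall>\<tau>. Im \<tau> > R \<longrightarrow> Some \<tau> \<in> U \<inter> V" if "None \<in> U \<inter> V"
  proof -
    obtain R1 R2 where "R1 > 0" "R2 > 0" "\<forall>\<tau>. Im \<tau> > R1 \<longrightarrow> Some \<tau> \<in> U"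
      "\<forall>\<tau>. Im \<tau> > R2 \<longrightarrow> Some \<tau> \<in> V"
      using U V \<open>None \<in> U \<inter> V\<close> unfolding open_extended_def by blast
    then show ?thesis by (intro exI[of _ "max R1 R2"]) auto
  qed
  have 2: "\<exists>r>0. \<forall>\<tau>\<in>ball (Complex (of_rat x) r) r. Some \<tau> \<in> U \<inter> V"
    if "Some (of_rat x) \<in> U \<inter> V" for x :: rat
  proof -
    have "\<exists>r>0. \<forall>\<tau>\<in>ball (Complex (of_rat x) r) r. Some \<tau> \<in> U"
      using U that by (simp add: open_extended_def)
    moreover have "\<exists>r>0. \<forall>\<tau>\<in>ball (Complex (of_rat x) r) r. Some \<tau> \<in> V"
      using V that by (simp add: open_extended_def)
    ultimately obtain r1 r2 where r: "r1 > 0" "r2 > 0"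
      "\<forall>\<tau>\<in>ball (Complex (of_rat x) r1) r1. Some \<tau> \<in> U"
      "\<forall>\<tau>\<in>ball (Complex (of_rat x) r2) r2. Some \<tau> \<in> V" by blast
    have sub: "ball (Complex (of_rat x) r) r \<subseteq> ball (Complex (of_rat x) s) s" if "r \<le> s" for r s
    proof
      fix \<tau> assume "\<tau> \<in> ball (Complex (of_rat x) r) r"
      moreover have "dist (Complex (of_rat x) s) (Complex (of_rat x) r) = s - r"
        using that by (simp add: dist_complex_def complex_diff cmod_def)
      ultimately show "\<tau> \<in> ball (Complex (of_rat x) s) s"
        using dist_triangle[of "Complex (of_rat x) s" \<tau> "Complex (of_rat x) r"]
        by (simp add: dist_commute)
    qed
    have "\<forall>\<tau>\<in>ball (Complex (of_rat x) (min r1 r2)) (min r1 r2). Some \<tau> \<in> U \<inter> V"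
      using r(3,4) sub[of "min r1 r2" r1] sub[of "min r1 r2" r2] by (simp add: subset_iff)
    moreover have "min r1 r2 > 0" using r by simp
    ultimately show ?thesis by blast
  qed
  show "open_extended (U \<inter> V)"
    unfolding open_extended_def eq
  proof (intro conjI)
    show "U \<inter> V \<subseteq> extended_plane" using U by (auto simp: open_extended_def)
    show "open ({\<tau> \<in> upper_half_plane. Some \<tau> \<in> U} \<inter> {\<tau> \<in> upper_half_plane. Some \<tau> \<in> V})"
      using U V by (intro open_Int) (simp_all add: open_extended_def)
  qed (use 1 2 in blast)+
next
  fix K assume K: "\<forall>U\<in>K. open_extended U"
  have eq: "{\<tau> \<in> upper_half_plane. Some \<tau> \<in> \<Union>K} =
      (\<Union>U\<in>K. {\<tau> \<in> upper_half_plane. Some \<tau> \<in> U})" by auto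
  have "open {\<tau> \<in> upper_half_plane. Some \<tau> \<in> \<Union>K}"
    unfolding eq using K by (intro open_UN) (auto simp: open_extended_def)
  then show "open_extended (\<Union>K)"
    unfolding open_extended_def
  proof (intro conjI impI allI)
    show "\<Union>K \<subseteq> extended_plane" using K by (auto simp: open_extended_def)
  next
    assume "None \<in> \<Union>K"
    then obtain U where "U \<in> K" "None \<in> U" by blast
    then have "\<exists>R>0. \<forall>\<tau>. Im \<tau> > R \<longrightarrow> Some \<tau> \<in> U" using K by (simp add: open_extended_def)
    with \<open>U \<in> K\<close> show "\<exists>R>0. \<forall>\<tau>. Im \<tau> > R \<longrightarrow> Some \<tau> \<in> \<Union>K" by blast
  next
    fix x :: rat assume "Some (of_rat x) \<in> \<Union>K"
    then obtain U where "U \<in> K" "Some (of_rat x) \<in> U" by blast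
    then have "\<exists>r>0. \<forall>\<tau>\<in>ball (Complex (of_rat x) r) r. Some \<tau> \<in> U"
      using K by (simp add: open_extended_def)
    with \<open>U \<in> K\<close> show "\<exists>r>0. \<forall>\<tau>\<in>ball (Complex (of_rat x) r) r. Some \<tau> \<in> \<Union>K" by blast
  qed
qed

lemma openin_modular_curve:
  "openin (modular_curve \<Gamma>) V \<longleftrightarrow> V \<subseteq> extended_plane // orbit_rel \<Gamma>
     \<and> open_extended {x \<in> extended_plane. orbit_rel \<Gamma> `` {x} \<in> V}"
proof -
  let ?p = "\<lambda>V. {x \<in> extended_plane. orbit_rel \<Gamma> `` {x} \<in> V}"
  have "istopology (\<lambda>V. V \<subseteq> extended_plane // orbit_rel \<Gamma> \<and> open_extended (?p V))"
    unfolding istopology_def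
  proof (intro conjI allI impI)
    fix U V
    assume U: "U \<subseteq> extended_plane // orbit_rel \<Gamma> \<and> open_extended (?p U)"
      and V: "V \<subseteq> extended_plane // orbit_rel \<Gamma> \<and> open_extended (?p V)"
    show "U \<inter> V \<subseteq> extended_plane // orbit_rel \<Gamma>" using U by blast
    have "?p (U \<inter> V) = ?p U \<inter> ?p V" by auto
    then show "open_extended (?p (U \<inter> V))"
      using U V istopology_open_extended by (simp add: istopology_def)
  next
    fix K assume K: "\<forall>U\<in>K. U \<subseteq> extended_plane // orbit_rel \<Gamma> \<and> open_extended (?p U)"
    then show "\<Union>K \<subseteq> extended_plane // orbit_rel \<Gamma>" by blast
    have "?p (\<Union>K) = \<Union>(?p ` K)" by auto
    moreover have "open_extended (\<Union>(?p ` K))"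
      using K istopology_open_extended unfolding istopology_def by simp
    ultimately show "open_extended (?p (\<Union>K))" by simp
  qed
  then show ?thesis by (simp add: modular_curve_def topology_inverse')
qed

text \<open>The genus of a closed orientable surface is half the rank of its first integral
  homology group.\<close>

definition has_genus :: "'a topology \<Rightarrow> nat \<Rightarrow> bool" where
  "has_genus X g \<longleftrightarrow> homology_group 1 X \<cong> free_Abelian_group {..<2 * g}"


section \<open>Weakly holomorphic modular forms with poles only at infinity\<close>

definition slash :: "nat \<Rightarrow> real^2^2 \<Rightarrow> (complex \<Rightarrow> complex) \<Rightarrow> complex \<Rightarrow> complex" where
  "slash k A F \<tau> = F (moebius_mat A \<tau>) / (of_real (A $ 2 $ 1) * \<tau> + of_real (A $ 2 $ 2)) ^ k"

text \<open>Expansion in powers of \<open>exp (2 \<pi> i \<tau> / w)\<close>; the coefficients are uniquely determined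
  by the function and the width \<open>w\<close>.\<close>

definition has_q_expansion :: "nat \<Rightarrow> (complex \<Rightarrow> complex) \<Rightarrow> (int \<Rightarrow> complex) \<Rightarrow> bool" where
  "has_q_expansion w F c \<longleftrightarrow> (\<forall>\<tau>\<in>upper_half_plane.
     ((\<lambda>n. c n * exp (2 * of_real pi * \<i> * of_int n * \<tau> / of_nat w)) has_sum F \<tau>) UNIV)"

text \<open>Every cusp is the image of infinity under some integral \<open>\<gamma>\<close>, and the order at this cusp
  of a form \<open>F\<close> is read off from the expansion of \<open>F\<close> slashed with \<open>\<gamma>\<close>.\<close>

definition order_at_cusp_ge :: "nat \<Rightarrow> real^2^2 \<Rightarrow> (complex \<Rightarrow> complex) \<Rightarrow> int \<Rightarrow> bool" where
  "order_at_cusp_ge k \<gamma> F M \<longleftrightarrow>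
     (\<exists>w>0. \<exists>c. has_q_expansion w (slash k \<gamma> F) c \<and> (\<forall>n<M. c n = 0))"

definition weakly_holomorphic_forms :: "nat \<Rightarrow> (real^2^2) set \<Rightarrow> (complex \<Rightarrow> complex) set" where
  "weakly_holomorphic_forms k \<Gamma> = {F. F holomorphic_on upper_half_plane
     \<and> (\<forall>\<gamma>\<in>\<Gamma>. \<forall>\<tau>\<in>upper_half_plane. slash k \<gamma> F \<tau> = F \<tau>)
     \<and> (\<forall>\<gamma>\<in>SL2Z. \<exists>M. order_at_cusp_ge k \<gamma> F M)}"

definition other_cusp :: "(real^2^2) set \<Rightarrow> real^2^2 \<Rightarrow> bool" where
  "other_cusp \<Gamma> \<gamma> \<longleftrightarrow> (None, moebius_ext \<gamma> None) \<notin> orbit_rel \<Gamma>"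

definition M0_infty :: "(real^2^2) set \<Rightarrow> (complex \<Rightarrow> complex) set" where
  "M0_infty \<Gamma> = {F \<in> weakly_holomorphic_forms 0 \<Gamma>.
     \<forall>\<gamma>\<in>SL2Z. other_cusp \<Gamma> \<gamma> \<longrightarrow> order_at_cusp_ge 0 \<gamma> F 0}"

definition S2_infty :: "(real^2^2) set \<Rightarrow> (complex \<Rightarrow> complex) set" where
  "S2_infty \<Gamma> = {F \<in> weakly_holomorphic_forms 2 \<Gamma>.
     \<forall>\<gamma>\<in>SL2Z. other_cusp \<Gamma> \<gamma> \<longrightarrow> order_at_cusp_ge 2 \<gamma> F 1}"

text \<open>A point of a compact Riemann surface of genus g is a Weierstrass point if some
  meromorphic function has a pole of order between 1 and g there and no other poles. The
  meromorphic functions on the modular curve with no pole away from infinity are the elements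
  of \<open>M0_infty\<close>, and \<open>q\<close> is a local parameter at infinity.\<close>

definition infinity_weierstrass_point :: "(real^2^2) set \<Rightarrow> nat \<Rightarrow> bool" where
  "infinity_weierstrass_point \<Gamma> g \<longleftrightarrow> (\<exists>F\<in>M0_infty \<Gamma>. \<exists>c. \<exists>m\<in>{1..g}.
     has_q_expansion 1 F c \<and> c (- int m) \<noteq> 0 \<and> (\<forall>n < - int m. c n = 0))"

text \<open>The functions \<open>f m\<close> with coefficients \<open>a m n\<close> (only meaningful for \<open>m > g\<close>), and the forms
  \<open>h n\<close> with coefficients \<open>b n m\<close> (only meaningful for \<open>n \<ge> - g\<close>, \<open>n \<noteq> 0\<close>). On the upper
  half-plane they are uniquely determined by these conditions.\<close>

definition is_f_family ::
  "(real^2^2) set \<Rightarrow> nat \<Rightarrow> (nat \<Rightarrow> complex \<Rightarrow> complex) \<Rightarrow> (nat \<Rightarrow> int \<Rightarrow> complex) \<Rightarrow> bool" where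
  "is_f_family \<Gamma> g f a \<longleftrightarrow>
     (\<forall>\<tau>\<in>upper_half_plane. f 0 \<tau> = 1) \<and>
     (\<forall>m\<in>{1..g}. \<forall>\<tau>\<in>upper_half_plane. f m \<tau> = 0) \<and>
     (\<forall>m\<ge>g + 1. f m \<in> M0_infty \<Gamma> \<and> has_q_expansion 1 (f m) (a m)
        \<and> a m (- int m) = 1 \<and> a m 0 = 0
        \<and> (\<forall>n < - int g. n \<noteq> - int m \<longrightarrow> a m n = 0))"

definition is_h_family ::
  "(real^2^2) set \<Rightarrow> nat \<Rightarrow> (int \<Rightarrow> complex \<Rightarrow> complex) \<Rightarrow> (int \<Rightarrow> int \<Rightarrow> complex) \<Rightarrow> bool" where
  "is_h_family \<Gamma> g h b \<longleftrightarrow>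
     (\<forall>n \<ge> - int g. n \<noteq> 0 \<longrightarrow> h n \<in> S2_infty \<Gamma> \<and> has_q_expansion 1 (h n) (b n)
        \<and> b n (- n) = 1 \<and> (\<forall>m \<le> int g. m \<noteq> - n \<longrightarrow> b n m = 0))"

definition A_fun :: "nat \<Rightarrow> (nat \<Rightarrow> complex \<Rightarrow> complex) \<Rightarrow> (nat \<Rightarrow> int \<Rightarrow> complex) \<Rightarrow>
    (int \<Rightarrow> complex \<Rightarrow> complex) \<Rightarrow> complex \<Rightarrow> complex \<Rightarrow> complex" where
  "A_fun g f a h \<tau>1 \<tau>2 =
     (\<Sum>l = - int g..int g + 1. of_int (1 - l) * a (g + 1) (- l) * h l \<tau>2)
   + (\<Sum>l = 1..g. f (l + g + 1) \<tau>1 * h (- int l) \<tau>2)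
   + (\<Sum>j = g + 1..2 * g. \<Sum>l = j - g..g.
        a (g + 1) (int l - int j) * f j \<tau>1 * h (- int l) \<tau>2)"

definition gen_rhs :: "nat \<Rightarrow> (nat \<Rightarrow> complex \<Rightarrow> complex) \<Rightarrow> (nat \<Rightarrow> int \<Rightarrow> complex) \<Rightarrow>
    (int \<Rightarrow> complex \<Rightarrow> complex) \<Rightarrow> complex \<Rightarrow> complex \<Rightarrow> complex" where
  "gen_rhs g f a h \<tau>1 \<tau>2 =
     - (1 / (2 * of_real pi * \<i>)) * (deriv (f (g + 1)) \<tau>2 / (f (g + 1) \<tau>2 - f (g + 1) \<tau>1))
     + A_fun g f a h \<tau>1 \<tau>2 / (f (g + 1) \<tau>2 - f (g + 1) \<tau>1)"

end

theory Submission
  imports Defs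
begin

text \<open>Multiplying out the denominator and comparing coefficients of powers of \<open>q\<^sub>2\<close>, the identity
  becomes a recurrence for the values of the \<open>f n\<close> at \<open>\<tau>1\<close>. It follows by expanding the
  product of \<open>f (g + 1)\<close> and \<open>f n\<close> in the functions \<open>f j\<close>, which is possible since a function in
  \<open>M0_infty\<close> is determined by the terms of its expansion of order at most zero: infinity is not
  a Weierstrass point, and a function without poles is constant by the maximum modulus principle.
  The coefficients of the \<open>h n\<close> enter through \<open>b n m = - a m n\<close>, the vanishing of the residue of
  \<open>f m\<close> times \<open>h n\<close>; the factors \<open>1 - l\<close> come from the residue of \<open>f n\<close> times the derivative of
  \<open>f (g + 1)\<close>. Convergence is automatic: the right-hand side is meromorphic in \<open>q\<^sub>2\<close> at zero, and
  its Laurent series is determined by the identity of formal Laurent series.\<close>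

section \<open>Matrices acting on the upper half-plane\<close>

unbundle no fps_syntax

text \<open>The two global facts about the curve, the vanishing of functions and the residue
  theorem, rest on a finiteness: invariance under \<open>Gamma0 N\<close> leaves only finitely many
  different functions \<open>slash k \<gamma> F\<close> as \<gamma> runs through
  \<open>SL2Z\<close>, and slashing by an integral matrix permutes them. The obstacle is that the
  scaled Atkin-Lehner matrices need not be integral, so \<Gamma> need not lie in
  \<open>SL2Z\<close>. Cosets are therefore taken with respect to \<open>Gamma0 N\<close>, and the
  rest of \<Gamma> enters only at a cusp that it identifies with infinity: there the slashed
  function is \<open>F\<close> itself after a real substitution
  \<open>\<tau> \<mapsto> \<alpha>\<^sup>2 * \<tau> + \<beta>\<close>. Such a cusp contributes
  \<open>\<alpha>\<^sup>2\<close> times the residue at infinity, so contributions of different cusps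
  cannot cancel, and this positivity takes the place of a computation of widths and indices.\<close>

abbreviation denom :: "real^2^2 \<Rightarrow> complex \<Rightarrow> complex" where
  "denom A \<tau> \<equiv> of_real (A $ 2 $ 1) * \<tau> + of_real (A $ 2 $ 2)"

lemma vector_2_2_nth [simp]:
  "(vector [vector [p, q], vector [r, s]] :: 'a::zero^2^2) $ 1 $ 1 = p"
  "(vector [vector [p, q], vector [r, s]] :: 'a::zero^2^2) $ 1 $ 2 = q"
  "(vector [vector [p, q], vector [r, s]] :: 'a::zero^2^2) $ 2 $ 1 = r"
  "(vector [vector [p, q], vector [r, s]] :: 'a::zero^2^2) $ 2 $ 2 = s"
  by (simp_all add: vector_2)

lemma matrix_mult_2_2_nth:
  fixes A B :: "'a::semiring_1^2^2"
  shows "(A ** B) $ i $ j = A $ i $ 1 * B $ 1 $ j + A $ i $ 2 * B $ 2 $ j"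
  by (simp add: matrix_matrix_mult_def sum_2)

lemma matrix_2_2_eqI:
  fixes A B :: "'a^2^2"
  assumes "A$1$1 = B$1$1" "A$1$2 = B$1$2" "A$2$1 = B$2$1" "A$2$2 = B$2$2"
  shows "A = B"
  using assms by (simp add: vec_eq_iff forall_2)

lemma denom_nonzero:
  assumes "det A = 1" "Im \<tau> > 0"
  shows "denom A \<tau> \<noteq> 0"
proof
  assume "denom A \<tau> = 0"
  then have "A $ 2 $ 1 * Im \<tau> = 0" "A $ 2 $ 1 * Re \<tau> + A $ 2 $ 2 = 0"
    by (simp_all add: complex_eq_iff)
  then have "A $ 2 $ 1 = 0" "A $ 2 $ 2 = 0" using assms(2) by auto
  then show False using assms(1) by (simp add: det_2)
qed

lemma Im_moebius_mat:
  assumes "det A = 1"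
  shows "Im (moebius_mat A \<tau>) = Im \<tau> / (norm (denom A \<tau>))\<^sup>2"
proof -
  have "Im (moebius_mat A \<tau>) =
      (A$1$1 * A$2$2 - A$1$2 * A$2$1) * Im \<tau> / ((A$2$1 * Re \<tau> + A$2$2)\<^sup>2 + (A$2$1 * Im \<tau>)\<^sup>2)"
    by (simp add: moebius_mat_def Im_divide algebra_simps)
  also have "\<dots> = Im \<tau> / (norm (denom A \<tau>))\<^sup>2"
    using assms by (simp add: det_2 cmod_power2)
  finally show ?thesis .
qed

lemma Im_moebius_mat_pos:
  assumes "det A = 1" "Im \<tau> > 0"
  shows "Im (moebius_mat A \<tau>) > 0"
  using denom_nonzero[OF assms] assms by (simp add: Im_moebius_mat)

lemma denom_mult:
  assumes "denom B \<tau> \<noteq> 0"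
  shows "denom (A ** B) \<tau> = denom A (moebius_mat B \<tau>) * denom B \<tau>"
  using assms by (simp add: moebius_mat_def matrix_mult_2_2_nth field_simps)

lemma moebius_mat_mult:
  assumes "denom B \<tau> \<noteq> 0"
  shows "moebius_mat (A ** B) \<tau> = moebius_mat A (moebius_mat B \<tau>)"
proof -
  have "of_real ((A ** B) $ 1 $ 1) * \<tau> + of_real ((A ** B) $ 1 $ 2) =
      (of_real (A$1$1) * moebius_mat B \<tau> + of_real (A$1$2)) * denom B \<tau>"
    using assms by (simp add: moebius_mat_def matrix_mult_2_2_nth field_simps)
  then show ?thesis
    using assms unfolding moebius_mat_def[of "A ** B"] denom_mult[OF assms] moebius_mat_def[of A]
    by simp
qed

lemma moebius_mat_1 [simp]: "moebius_mat (mat 1) \<tau> = \<tau>"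
  by (simp add: moebius_mat_def mat_def)

text \<open>The cocycle relation \<open>denom_mult\<close> makes slashing a right action: a product
  slashes by its left factor first.\<close>

lemma slash_mult:
  assumes "det B = 1" "Im \<tau> > 0"
  shows "slash k (A ** B) F \<tau> = slash k B (slash k A F) \<tau>"
  using denom_nonzero[OF assms]
  by (simp add: slash_def denom_mult moebius_mat_mult power_mult_distrib)

lemma slash_1 [simp]: "slash k (mat 1) F \<tau> = F \<tau>"
  by (simp add: slash_def mat_def moebius_mat_def)

lemma slash_cong:
  assumes "\<And>\<tau>. Im \<tau> > 0 \<Longrightarrow> F \<tau> = G \<tau>" "det A = 1" "Im \<tau> > 0"
  shows "slash k A F \<tau> = slash k A G \<tau>"
  using assms Im_moebius_mat_pos by (simp add: slash_def)

text \<open>The derivative is the inverse of the weight two automorphy factor. Hence differentiation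
  takes weight 0 to weight 2, and a primitive of a weight two form changes only by a constant under
  each matrix that fixes the form.\<close>

lemma has_field_derivative_moebius_mat:
  assumes "det A = 1" "Im \<tau> > 0"
  shows "(moebius_mat A has_field_derivative 1 / (denom A \<tau>)\<^sup>2) (at \<tau>)"
proof -
  have det: "(of_real (A$1$1) * of_real (A$2$2) - of_real (A$1$2) * of_real (A$2$1) :: complex) = 1"
    using assms(1) by (metis (no_types) det_2 of_real_1 of_real_diff of_real_mult)
  show ?thesis
    unfolding moebius_mat_def[abs_def]
    apply (rule derivative_eq_intros refl denom_nonzero[OF assms])+
    using det by (simp add: power2_eq_square algebra_simps)
qed

lemma open_upper_half_plane: "open upper_half_plane"
  by (rule open_halfspace_Im_gt)

lemma convex_upper_half_plane: "convex upper_half_plane"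
  by (rule convex_halfspace_Im_gt)

lemma connected_upper_half_plane: "connected upper_half_plane"
  by (simp add: convex_connected convex_upper_half_plane)

section \<open>Integral matrices and the group \<Gamma>\<close>

lemma SL2Z_det: "A \<in> SL2Z \<Longrightarrow> det A = 1"
  by (simp add: SL2Z_def)

lemma SL2Z_mult: "A \<in> SL2Z \<Longrightarrow> B \<in> SL2Z \<Longrightarrow> A ** B \<in> SL2Z"
  by (auto simp: SL2Z_def det_mul matrix_mult_2_2_nth)

lemma SL2Z_one: "mat 1 \<in> SL2Z"
  by (auto simp: SL2Z_def) (auto simp: mat_def)

text \<open>The adjugate: the inverse at determinant one, written without division so that integral
  entries visibly stay integral.\<close>

definition inverse_2_2 :: "real^2^2 \<Rightarrow> real^2^2" where
  "inverse_2_2 A = vector [vector [A$2$2, - A$1$2], vector [- A$2$1, A$1$1]]"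

lemma det_inverse_2_2 [simp]: "det (inverse_2_2 A) = det A"
  by (simp add: inverse_2_2_def det_2)

lemma inverse_2_2_left: "det A = 1 \<Longrightarrow> inverse_2_2 A ** A = mat 1"
  by (rule matrix_2_2_eqI)
     (simp_all add: inverse_2_2_def det_2 matrix_mult_2_2_nth mat_def algebra_simps)

lemma inverse_2_2_right: "det A = 1 \<Longrightarrow> A ** inverse_2_2 A = mat 1"
  by (rule matrix_2_2_eqI)
     (simp_all add: inverse_2_2_def det_2 matrix_mult_2_2_nth mat_def algebra_simps)

lemma SL2Z_inverse: "A \<in> SL2Z \<Longrightarrow> inverse_2_2 A \<in> SL2Z"
  by (auto simp: SL2Z_def forall_2) (auto simp: inverse_2_2_def)

lemma moebius_mat_inverse_2_2:
  assumes "det A = 1" "Im \<tau> > 0"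
  shows "moebius_mat A (moebius_mat (inverse_2_2 A) \<tau>) = \<tau>"
  using moebius_mat_mult[OF denom_nonzero[of "inverse_2_2 A" \<tau>], of A] assms
  by (simp add: inverse_2_2_right)

lemma Gamma0_subset_Gamma_plus: "Gamma0 N \<subseteq> Gamma_plus N S"
  by (auto simp: Gamma_plus_def intro: generate.incl)

text \<open>The factor \<open>1 / sqrt Q\<close> normalises the Atkin-Lehner determinant
  \<open>Q\<close> to one; \<open>Q\<close> is positive because it divides \<open>N\<close>. The
  generators then lie in the group \<open>SL2R\<close>, hence so does what they generate.\<close>

lemma det_Gamma_plus:
  assumes "N > 0" "S \<subseteq> exact_divisors N" "A \<in> Gamma_plus N S"
  shows "det A = 1"
proof -
  have "B \<in> carrier SL2R" if "Q \<in> S" "B \<in> atkin_lehner Q N" for Q B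
  proof -
    have "Q > 0" using assms(1,2) that(1) by (auto simp: exact_divisors_def intro!: Nat.gr0I)
    from that(2) obtain x y z w :: int where
      B: "B = (1 / sqrt (real Q)) *\<^sub>R vector [vector [of_int (int Q * x), of_int y],
            vector [of_int (int N * z), of_int (int Q * w)]]"
      and eq: "(int Q * x) * (int Q * w) - y * (int N * z) = int Q"
      by (auto simp: atkin_lehner_def)
    have eq': "real Q * real_of_int x * (real Q * real_of_int w) - real_of_int y * (real N * real_of_int z) = real Q"
      using arg_cong[OF eq, of real_of_int] by simp
    have "det B = (real Q * real_of_int x * (real Q * real_of_int w) - real_of_int y * (real N * real_of_int z)) / (sqrt (real Q))\<^sup>2"
      using \<open>Q > 0\<close> by (simp add: B det_2 power2_eq_square field_simps)
    then show ?thesis using eq' \<open>Q > 0\<close> by (simp add: SL2R_def)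
  qed
  then have "Gamma0 N \<union> (\<Union>Q\<in>S. atkin_lehner Q N) \<subseteq> carrier SL2R"
    by (auto simp: Gamma0_def SL2Z_det) (simp add: SL2R_def SL2Z_det)
  from group.generate_in_carrier[OF group_SL2R this] assms(3) show ?thesis
    by (simp add: Gamma_plus_def SL2R_def)
qed

text \<open>Each inversion at least doubles an imaginary part below 1/2.\<close>

lemma SL2Z_reduction:
  assumes "Im \<tau> > 0"
  shows "\<exists>\<gamma>\<in>SL2Z. \<exists>\<sigma>. Im \<sigma> \<ge> 1/2 \<and> \<tau> = moebius_mat \<gamma> \<sigma>"
proof -
  \<comment> \<open>\<open>k\<close> bounds the number of inversions still needed.\<close>
  have "\<exists>\<gamma>\<in>SL2Z. \<exists>\<sigma>. Im \<sigma> \<ge> 1/2 \<and> \<tau> = moebius_mat \<gamma> \<sigma>" if "Im \<tau> > 0" "2 ^ k * Im \<tau> \<ge> 1/2" for k \<tau>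
    using that
  proof (induction k arbitrary: \<tau>)
    case 0
    then show ?case by (intro bexI[of _ "mat 1"] exI[of _ \<tau>]) (auto simp: SL2Z_one)
  next
    case (Suc k)
    show ?case
    proof (cases "Im \<tau> \<ge> 1/2")
      case True
      then show ?thesis by (intro bexI[of _ "mat 1"] exI[of _ \<tau>]) (auto simp: SL2Z_one)
    next
      case False
      define n where "n = round (Re \<tau>)"
      \<comment> \<open>\<open>A\<close> is translation by \<open>- n\<close> followed by inversion,
        \<open>\<tau> \<mapsto> - 1 / (\<tau> - n)\<close>. Rounding and the case assumption bound
        the squared norm of its denominator by 1/4 + 1/4.\<close>
      define A :: "real^2^2" where "A = vector [vector [0, -1], vector [1, - of_int n]]"
      have A: "A \<in> SL2Z" by (auto simp: SL2Z_def A_def det_2 forall_2)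
      then have inv: "inverse_2_2 A \<in> SL2Z" by (rule SL2Z_inverse)
      have "\<bar>Re \<tau> - of_int n\<bar> \<le> 1/2"
        using of_int_round_abs_le[of "Re \<tau>"] unfolding n_def by linarith
      then have "(Re \<tau> - of_int n)\<^sup>2 \<le> (1/2)\<^sup>2" by (rule power2_le_iff_abs_le[THEN iffD2, rotated]) simp
      moreover have "(Im \<tau>)\<^sup>2 \<le> (1/2)\<^sup>2" using False Suc.prems(1) by (intro power_mono) auto
      moreover have "(norm (denom A \<tau>))\<^sup>2 = (Re \<tau> - of_int n)\<^sup>2 + (Im \<tau>)\<^sup>2"
        by (simp add: cmod_power2 A_def)
      ultimately have le: "(norm (denom A \<tau>))\<^sup>2 \<le> 1/2" by (simp add: power2_eq_square)
      have pos: "(norm (denom A \<tau>))\<^sup>2 > 0"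
        using denom_nonzero[OF SL2Z_det[OF A] Suc.prems(1)] by simp
      have "Im (moebius_mat A \<tau>) = Im \<tau> / (norm (denom A \<tau>))\<^sup>2"
        by (rule Im_moebius_mat[OF SL2Z_det[OF A]])
      also have "\<dots> \<ge> 2 * Im \<tau>" using le pos Suc.prems(1) by (simp add: pos_le_divide_eq mult_left_le)
      finally have Im2: "Im (moebius_mat A \<tau>) \<ge> 2 * Im \<tau>" .
      then have "2 ^ k * (2 * Im \<tau>) \<le> 2 ^ k * Im (moebius_mat A \<tau>)" by (intro mult_left_mono) auto
      moreover have "2 ^ k * (2 * Im \<tau>) = 2 ^ Suc k * Im \<tau>" by simp
      ultimately have "2 ^ k * Im (moebius_mat A \<tau>) \<ge> 1/2" using Suc.prems(2) by linarith
      moreover have "Im (moebius_mat A \<tau>) > 0" using Im2 Suc.prems(1) by simp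
      ultimately obtain \<gamma> \<sigma> where \<gamma>: "\<gamma> \<in> SL2Z" "Im \<sigma> \<ge> 1/2" "moebius_mat A \<tau> = moebius_mat \<gamma> \<sigma>"
        using Suc.IH by blast
      have "\<tau> = moebius_mat (inverse_2_2 A ** A) \<tau>"
        using SL2Z_det[OF A] by (simp add: inverse_2_2_left)
      also have "\<dots> = moebius_mat (inverse_2_2 A) (moebius_mat \<gamma> \<sigma>)"
        using moebius_mat_mult[OF denom_nonzero[OF SL2Z_det[OF A] Suc.prems(1)]] \<gamma>(3) by simp
      also have "\<dots> = moebius_mat (inverse_2_2 A ** \<gamma>) \<sigma>"
        using \<gamma>(2) by (intro moebius_mat_mult[symmetric] denom_nonzero SL2Z_det[OF \<gamma>(1)]) auto
      finally show ?thesis using SL2Z_mult[OF inv \<gamma>(1)] \<gamma>(2) by blast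
    qed
  qed
  moreover obtain k where "2 ^ k > 1 / Im \<tau>" using real_arch_pow[of 2 "1 / Im \<tau>"] by auto
  then have "2 ^ k * Im \<tau> \<ge> 1/2" using assms by (simp add: field_simps)
  ultimately show ?thesis using assms by blast
qed

text \<open>The value 0 off the upper half-plane turns agreement on the half-plane into equality of
  functions, so that the slashed functions can be counted and summed as a finite set.\<close>

definition coset_function :: "nat \<Rightarrow> (complex \<Rightarrow> complex) \<Rightarrow> real^2^2 \<Rightarrow> complex \<Rightarrow> complex" where
  "coset_function k F \<gamma> = (\<lambda>\<tau>. if Im \<tau> > 0 then slash k \<gamma> F \<tau> else 0)"

text \<open>The slashed function only depends on the bottom row modulo N.\<close>

lemma finite_coset_functions:
  assumes "N > 0" and inv: "\<And>\<gamma> \<tau>. \<gamma> \<in> Gamma0 N \<Longrightarrow> Im \<tau> > 0 \<Longrightarrow> slash k \<gamma> F \<tau> = F \<tau>"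
  shows "finite (coset_function k F ` SL2Z)"
proof -
  define key where "key A = (\<lfloor>A$2$1\<rfloor> mod int N, \<lfloor>A$2$2\<rfloor> mod int N)" for A :: "real^2^2"
  have "key ` SL2Z \<subseteq> {0..<int N} \<times> {0..<int N}" using assms(1) by (auto simp: key_def)
  then have fin: "finite (key ` SL2Z)" by (rule finite_subset) simp
  have eq: "coset_function k F A = coset_function k F B" if A: "A \<in> SL2Z" and B: "B \<in> SL2Z" and "key A = key B" for A B
  proof -
    define C where "C = A ** inverse_2_2 B"
    have C: "C \<in> SL2Z" using A SL2Z_inverse[OF B] by (simp add: C_def SL2Z_mult)
    have ints: "of_int \<lfloor>A$2$1\<rfloor> = A$2$1" "of_int \<lfloor>A$2$2\<rfloor> = A$2$2" "of_int \<lfloor>B$2$1\<rfloor> = B$2$1" "of_int \<lfloor>B$2$2\<rfloor> = B$2$2"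
      using A B by (auto simp: SL2Z_def)
    \<comment> \<open>The lower left entry of \<open>C\<close> is the determinant formed by the
      bottom rows of \<open>A\<close> and \<open>B\<close>; it vanishes modulo \<open>N\<close> when
      these rows agree modulo \<open>N\<close>.\<close>
    have C21: "C$2$1 = of_int (\<lfloor>A$2$1\<rfloor> * \<lfloor>B$2$2\<rfloor> - \<lfloor>A$2$2\<rfloor> * \<lfloor>B$2$1\<rfloor>)"
      by (simp add: C_def matrix_mult_2_2_nth inverse_2_2_def ints)
    have "(\<lfloor>A$2$1\<rfloor> * \<lfloor>B$2$2\<rfloor>) mod int N = (\<lfloor>A$2$2\<rfloor> * \<lfloor>B$2$1\<rfloor>) mod int N"
      using \<open>key A = key B\<close> mod_mult_cong[of "\<lfloor>A$2$1\<rfloor>" "int N" "\<lfloor>B$2$1\<rfloor>" "\<lfloor>B$2$2\<rfloor>" "\<lfloor>A$2$2\<rfloor>"]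
      by (simp add: key_def mult.commute)
    then have "int N dvd \<lfloor>A$2$1\<rfloor> * \<lfloor>B$2$2\<rfloor> - \<lfloor>A$2$2\<rfloor> * \<lfloor>B$2$1\<rfloor>"
      by (simp add: mod_eq_dvd_iff)
    then have CN: "C \<in> Gamma0 N" using C C21 by (auto simp: Gamma0_def dvd_def simp del: of_int_mult of_int_diff)
    have CB: "C ** B = A"
      using SL2Z_det[OF B] by (simp add: C_def matrix_mul_assoc[symmetric] inverse_2_2_left)
    have "slash k A F \<tau> = slash k B F \<tau>" if "Im \<tau> > 0" for \<tau>
    proof -
      have "slash k A F \<tau> = slash k B (slash k C F) \<tau>"
        using slash_mult[OF SL2Z_det[OF B] that, of k C F] unfolding CB .
      also have "\<dots> = slash k B F \<tau>"
        by (rule slash_cong[OF _ SL2Z_det[OF B] that]) (rule inv[OF CN])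
      finally show ?thesis .
    qed
    then show ?thesis by (auto simp: coset_function_def)
  qed
  define rep where "rep q = (SOME A. A \<in> SL2Z \<and> key A = q)" for q
  have "coset_function k F ` SL2Z \<subseteq> (\<lambda>q. coset_function k F (rep q)) ` key ` SL2Z"
  proof
    fix G assume "G \<in> coset_function k F ` SL2Z"
    then obtain A where A: "A \<in> SL2Z" "G = coset_function k F A" by blast
    then have "rep (key A) \<in> SL2Z \<and> key (rep (key A)) = key A"
      unfolding rep_def by (intro someI[of "\<lambda>B. B \<in> SL2Z \<and> key B = key A" A]) auto
    then have "G = coset_function k F (rep (key A))" using eq[of A "rep (key A)"] A by metis
    then show "G \<in> (\<lambda>q. coset_function k F (rep q)) ` key ` SL2Z" using A by blast
  qed
  then show ?thesis by (rule finite_subset) (simp add: fin)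
qed

text \<open>If \<gamma> and some \<delta> in \<Gamma> send infinity to the same cusp, then
  \<open>U\<close>, the product of the inverse of \<delta> with \<gamma>, fixes infinity: it is
  upper triangular with diagonal \<open>\<alpha>\<close>, \<open>1 / \<alpha>\<close> and acts by an
  affine map. Since \<delta> need not be integral, \<alpha> can differ from 1 and -1.\<close>

lemma cusp_equivalent_to_infinity:
  assumes \<Gamma>: "\<And>\<gamma>. \<gamma> \<in> \<Gamma> \<Longrightarrow> det \<gamma> = 1" and \<gamma>: "\<gamma> \<in> SL2Z" "\<not> other_cusp \<Gamma> \<gamma>"
    and inv: "\<And>\<gamma> \<tau>. \<gamma> \<in> \<Gamma> \<Longrightarrow> Im \<tau> > 0 \<Longrightarrow> slash k \<gamma> F \<tau> = F \<tau>"
  obtains \<alpha> \<beta> :: real where "\<alpha> \<noteq> 0"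
    "\<And>\<tau>. Im \<tau> > 0 \<Longrightarrow> slash k \<gamma> F \<tau> = of_real (\<alpha> ^ k) * F (of_real (\<alpha>\<^sup>2) * \<tau> + of_real \<beta>)"
proof -
  from \<gamma>(2) obtain \<delta> where \<delta>: "\<delta> \<in> \<Gamma>" "moebius_ext \<gamma> None = moebius_ext \<delta> None"
    by (auto simp: other_cusp_def orbit_rel_def)
  note d = \<Gamma>[OF \<delta>(1)] SL2Z_det[OF \<gamma>(1)]
  define U where "U = inverse_2_2 \<delta> ** \<gamma>"
  have detU: "det U = 1" using d by (simp add: U_def det_mul)
  have "U$2$1 = 0"
    using \<delta>(2) by (auto simp: U_def matrix_mult_2_2_nth inverse_2_2_def field_simps
        simp flip: of_real_mult split: if_splits)
  then have U: "U$1$1 * U$2$2 = 1" using detU by (simp add: det_2)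
  define \<alpha> where "\<alpha> = U$1$1"
  have "\<alpha> \<noteq> 0" using U by (auto simp: \<alpha>_def)
  then have "U$2$2 = 1 / \<alpha>" using U by (metis \<alpha>_def nonzero_eq_divide_eq mult.commute)
  have "\<delta> ** U = \<gamma>" using d by (simp add: U_def matrix_mul_assoc inverse_2_2_right)
  then have "slash k \<gamma> F \<tau> = slash k U F \<tau>" if "Im \<tau> > 0" for \<tau>
    using slash_mult[OF detU that, of k \<delta> F]
      slash_cong[of "slash k \<delta> F" F, OF _ detU that] inv[OF \<delta>(1)] by metis
  moreover have "slash k U F \<tau> = of_real (\<alpha> ^ k) * F (of_real (\<alpha>\<^sup>2) * \<tau> + of_real (\<alpha> * U$1$2))" for \<tau>
    using \<open>\<alpha> \<noteq> 0\<close> unfolding slash_def moebius_mat_def \<open>U$2$1 = 0\<close> \<open>U$2$2 = 1 / \<alpha>\<close> \<alpha>_def[symmetric]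
    by (simp add: power2_eq_square algebra_simps power_divide)
  ultimately show ?thesis using that[of \<alpha> "\<alpha> * U$1$2"] \<open>\<alpha> \<noteq> 0\<close> by simp
qed

section \<open>Expansions at the cusps\<close>

definition nome :: "nat \<Rightarrow> complex \<Rightarrow> complex" where
  "nome w \<tau> = exp (2 * of_real pi * \<i> * \<tau> / of_nat w)"

lemma nome_nonzero [simp]: "nome w \<tau> \<noteq> 0"
  by (simp add: nome_def)

lemma norm_nome: "norm (nome w \<tau>) = exp (- 2 * pi * Im \<tau> / real w)"
  by (simp add: nome_def norm_exp_eq_Re Re_divide_of_nat)

lemma norm_nome_less_1: "w > 0 \<Longrightarrow> Im \<tau> > 0 \<Longrightarrow> norm (nome w \<tau>) < 1"
  by (simp add: norm_nome)

lemma nome_powi: "nome w \<tau> powi n = exp (2 * of_real pi * \<i> * of_int n * \<tau> / of_nat w)"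
  unfolding nome_def by (simp add: exp_power_int mult_ac)

lemma nome_add_width: "w > 0 \<Longrightarrow> nome w (\<tau> + of_nat w) = nome w \<tau>"
  by (simp add: nome_def add_divide_distrib ring_distribs exp_add)

lemma nome_Ln:
  assumes "w > 0" "exp u = z" "norm z < 1"
  shows "nome w (of_nat w * u / (2 * of_real pi * \<i>)) = z"
    and "Im (of_nat w * u / (2 * of_real pi * \<i>)) > 0"
proof -
  show "nome w (of_nat w * u / (2 * of_real pi * \<i>)) = z"
    using assms by (simp add: nome_def)
  have "exp (Re u) < 1" using assms(2,3) by (metis norm_exp_eq_Re)
  moreover have "of_nat w * u / (2 * of_real pi * \<i>) = - \<i> * of_real (real w / (2 * pi)) * u"
    by (simp add: field_simps)
  ultimately show "Im (of_nat w * u / (2 * of_real pi * \<i>)) > 0"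
    using assms(1) by (simp add: mult_less_0_iff divide_neg_pos mult_pos_neg)
qed

lemma nome_surj:
  assumes "w > 0" "z \<noteq> 0" "norm z < 1"
  obtains \<tau> where "Im \<tau> > 0" "nome w \<tau> = z"
  using nome_Ln[OF assms(1) exp_Ln[OF assms(2)] assms(3)] that by blast

lemma nome_has_field_derivative [derivative_intros]:
  "(nome w has_field_derivative 2 * of_real pi * \<i> / of_nat w * nome w \<tau>) (at \<tau> within A)"
  unfolding nome_def[abs_def] divide_inverse by (auto intro!: derivative_eq_intros)

lemma nome_in_ball:
  "w > 0 \<Longrightarrow> Im \<tau> > 0 \<Longrightarrow> 1 \<le> r \<Longrightarrow> ereal (norm (nome w \<tau>)) < r"
  using norm_nome_less_1[of w \<tau>] by (metis ereal_less(3) less_le_trans)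

lemma periodic_int_multiple:
  assumes "\<And>\<tau>. Im \<tau> > 0 \<Longrightarrow> F (\<tau> + of_nat w) = F \<tau>" "Im \<tau> > 0"
  shows "F (\<tau> + of_int n * of_nat w) = F \<tau>"
proof -
  have pos: "F (\<tau> + of_nat k * of_nat w) = F \<tau>" if "Im \<tau> > 0" for k \<tau>
  proof (induction k)
    case (Suc k)
    have "F (\<tau> + of_nat (Suc k) * of_nat w) = F ((\<tau> + of_nat k * of_nat w) + of_nat w)"
      by (simp add: algebra_simps)
    also have "\<dots> = F \<tau>" using Suc that by (subst assms(1)) auto
    finally show ?case .
  qed simp
  show ?thesis
  proof (cases "n \<ge> 0")
    case True
    then show ?thesis using pos[OF assms(2), of "nat n"] by simp
  next
    case False
    then show ?thesis using pos[of "\<tau> + of_int n * of_nat w" "nat (-n)"] assms(2) by simp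
  qed
qed

lemma periodic_nome_eq:
  assumes "\<And>\<tau>. Im \<tau> > 0 \<Longrightarrow> F (\<tau> + of_nat w) = F \<tau>"
    and "w > 0" "Im \<tau> > 0" "Im \<sigma> > 0" "nome w \<tau> = nome w \<sigma>"
  shows "F \<tau> = F \<sigma>"
proof -
  obtain n :: int where "2 * of_real pi * \<i> * \<tau> / of_nat w = 2 * of_real pi * \<i> * \<sigma> / of_nat w + (of_int (2 * n) * of_real pi) * \<i>"
    using assms(5) unfolding nome_def exp_eq by auto
  then have "2 * of_real pi * \<i> * \<tau> = 2 * of_real pi * \<i> * (\<sigma> + of_int n * of_nat w)"
    using assms(2) by (simp add: field_simps)
  then have "\<tau> = \<sigma> + of_int n * of_nat w"
    by (metis (no_types) complex_i_not_zero mult_cancel_left mult_eq_0_iff of_real_eq_0_iff pi_neq_zero zero_neq_numeral)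
  then show ?thesis using periodic_int_multiple[of F w \<sigma> n] assms(1,4) by simp
qed

lemma constant_on_upper_half_plane:
  assumes "\<And>\<tau>. Im \<tau> > 0 \<Longrightarrow> (F has_field_derivative 0) (at \<tau>)"
  obtains c where "\<And>\<tau>. Im \<tau> > 0 \<Longrightarrow> F \<tau> = c"
  using has_field_derivative_0_imp_constant_on[OF _ connected_upper_half_plane open_upper_half_plane, of F] assms
  unfolding constant_on_def by auto

text \<open>A formal Laurent series has only finitely many negative exponents, so this is an
  expansion that is meromorphic at the cusp. Products and derivatives become operations on formal
  series, with convergence on the punctured unit disc carried along.\<close>

definition q_series :: "nat \<Rightarrow> (complex \<Rightarrow> complex) \<Rightarrow> complex fls \<Rightarrow> bool" where
  "q_series w F L \<longleftrightarrow> 1 \<le> fls_conv_radius L \<and> (\<forall>\<tau>. Im \<tau> > 0 \<longrightarrow> F \<tau> = eval_fls L (nome w \<tau>))"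

lemma q_series_imp_has_q_expansion:
  assumes "q_series w F L" "w > 0"
  shows "has_q_expansion w F (fls_nth L)"
  unfolding has_q_expansion_def
proof
  fix \<tau> assume "\<tau> \<in> upper_half_plane"
  then have \<tau>: "Im \<tau> > 0" by simp
  define z where "z = nome w \<tau>"
  have z: "z \<noteq> 0" "ereal (norm z) < fls_conv_radius L"
    using nome_in_ball[OF assms(2) \<tau>] assms(1) by (auto simp: z_def q_series_def)
  define d where "d = fls_subdegree L"
  have "summable (\<lambda>k. norm (fls_nth L (int k + d) * z ^ k) * norm (z powi d))"
    using norm_summable_fls'[OF z(2)] by (intro summable_mult2) (simp add: d_def)
  then have "summable (\<lambda>k. norm (fls_nth L (int k + d) * z powi (int k + d)))"
    using z(1) by (simp add: power_int_add norm_mult mult_ac)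
  moreover have "(\<lambda>k. fls_nth L (int k + d) * z powi (int k + d)) sums eval_fls L z"
    unfolding d_def by (rule sums_eval_fls) (use z in auto)
  ultimately have "((\<lambda>k. fls_nth L (int k + d) * z powi (int k + d)) has_sum eval_fls L z) UNIV"
    by (rule norm_summable_imp_has_sum)
  then have "((\<lambda>n. fls_nth L n * z powi n) has_sum eval_fls L z) {d..}"
    by (rule has_sum_reindex_bij_witness[of _ "\<lambda>n. nat (n - d)" "\<lambda>k. int k + d", THEN iffD1, rotated -1]) auto
  then have "((\<lambda>n. fls_nth L n * z powi n) has_sum eval_fls L z) UNIV"
    by (rule has_sum_cong_neutral[THEN iffD1, rotated -1]) (auto simp: d_def)
  then show "((\<lambda>n. fls_nth L n * exp (2 * of_real pi * \<i> * of_int n * \<tau> / of_nat w)) has_sum F \<tau>) UNIV"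
    using assms(1) \<tau> by (simp add: z_def nome_powi q_series_def)
qed

lemma has_q_expansion_imp_q_series:
  assumes "has_q_expansion w F c" "w > 0" and M: "\<And>n. n < M \<Longrightarrow> c n = 0"
  shows "q_series w F (Abs_fls c)"
proof -
  define L where "L = Abs_fls c"
  have L: "fls_nth L = c"
    unfolding L_def by (rule ext, rule nth_Abs_fls_lower_bound[of M]) (use M in blast)
  have sums: "(\<lambda>k. c (int k + M) * z powi (int k + M)) sums F \<tau>"
    if "Im \<tau> > 0" "z = nome w \<tau>" for \<tau> z
  proof -
    have "((\<lambda>n. c n * z powi n) has_sum F \<tau>) UNIV"
      using assms(1) that by (simp add: has_q_expansion_def nome_powi)
    then have "((\<lambda>n. c n * z powi n) has_sum F \<tau>) {M..}"
      by (rule has_sum_cong_neutral[THEN iffD1, rotated -1]) (auto simp: M)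
    then have "((\<lambda>k. c (int k + M) * z powi (int k + M)) has_sum F \<tau>) UNIV"
      by (rule has_sum_reindex_bij_witness[of _ "\<lambda>n. nat (n - M)" "\<lambda>k. int k + M", THEN iffD2, rotated -1]) auto
    then show ?thesis by (rule has_sum_imp_sums)
  qed
  define p where "p = Abs_fps (\<lambda>k. c (int k + M))"
  have Lp: "L = fls_shift (- M) (fps_to_fls p)"
    by (rule fls_eqI) (auto simp: L p_def M)
  have "fps_conv_radius p \<ge> 1"
    unfolding fps_conv_radius_def
  proof (rule conv_radius_geI_ex')
    fix r :: real assume r: "0 < r" "ereal r < 1"
    \<comment> \<open>Every radius below 1 is a value of the nome, and the expansion is summable at
      each point of the half-plane.\<close>
    then obtain \<tau> where "Im \<tau> > 0" "nome w \<tau> = complex_of_real r"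
      using nome_surj[of w "of_real r"] assms(2) by (auto simp: one_ereal_def)
    then have "summable (\<lambda>k. c (int k + M) * of_real r powi (int k + M) * of_real r powi (-M))"
      using sums[of \<tau> "of_real r"] by (intro summable_mult2) (auto simp: sums_iff)
    then show "summable (\<lambda>n. fps_nth p n * of_real r ^ n)"
      using r by (simp add: p_def power_int_add mult_ac power_int_minus field_simps)
  qed
  then have "1 \<le> fls_conv_radius L" by (simp add: Lp)
  moreover have "F \<tau> = eval_fls L (nome w \<tau>)" if "Im \<tau> > 0" for \<tau>
  proof (cases "L = 0")
    \<comment> \<open>The zero series needs its own case: its subdegree is 0 by convention, which
      can be smaller than \<open>M\<close>.\<close>
    case True
    then have "c = (\<lambda>_. 0)" using L by (auto simp: fun_eq_iff)
    then show ?thesis using sums[OF that refl] True sums_unique by force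
  next
    case False
    then have "M \<le> fls_subdegree L"
      by (intro fls_subdegree_geI) (auto simp: L M)
    then show ?thesis
      by (intro eval_fls_eq[symmetric, of M]) (use sums[OF that refl] in \<open>auto simp: L\<close>)
  qed
  ultimately show ?thesis by (simp add: q_series_def L_def)
qed

lemma q_series_cong:
  assumes "q_series w F L" "\<And>\<tau>. Im \<tau> > 0 \<Longrightarrow> G \<tau> = F \<tau>"
  shows "q_series w G L"
  using assms by (simp add: q_series_def)

lemma q_series_add:
  assumes "q_series w F L" "q_series w G K" "w > 0"
  shows "q_series w (\<lambda>\<tau>. F \<tau> + G \<tau>) (L + K)"
  using assms nome_in_ball[OF assms(3)]
  by (auto simp: q_series_def eval_fls_add intro!: fls_conv_radius_add_ge)

lemma q_series_mult:
  assumes "q_series w F L" "q_series w G K" "w > 0"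
  shows "q_series w (\<lambda>\<tau>. F \<tau> * G \<tau>) (L * K)"
  using assms nome_in_ball[OF assms(3)]
  by (auto simp: q_series_def eval_fls_mult intro!: fls_conv_radius_mult_ge)

lemma q_series_const: "q_series w (\<lambda>\<tau>. c) (fls_const c)"
  by (simp add: q_series_def)

lemma q_series_sum:
  assumes "\<And>i. i \<in> I \<Longrightarrow> q_series w (F i) (L i)" "w > 0"
  shows "q_series w (\<lambda>\<tau>. \<Sum>i\<in>I. F i \<tau>) (\<Sum>i\<in>I. L i)"
  using assms(1)
  by (induction I rule: infinite_finite_induct)
     (use q_series_const[of w 0] in \<open>auto intro!: q_series_add assms(2)\<close>)

lemma q_series_has_field_derivative:
  assumes "q_series w F L" "w > 0" "Im \<tau> > 0"
  shows "(F has_field_derivative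
      2 * of_real pi * \<i> / of_nat w * (nome w \<tau> * eval_fls (fls_deriv L) (nome w \<tau>))) (at \<tau>)"
proof -
  have "nome w \<tau> \<in> eball 0 (fls_conv_radius L) - {0}"
    using nome_in_ball[OF assms(2,3)] assms(1) by (auto simp: q_series_def)
  from DERIV_chain2[OF has_field_derivative_eval_fls[OF this] nome_has_field_derivative]
  have "((\<lambda>\<tau>. eval_fls L (nome w \<tau>)) has_field_derivative
      2 * of_real pi * \<i> / of_nat w * (nome w \<tau> * eval_fls (fls_deriv L) (nome w \<tau>))) (at \<tau>)"
    by (simp add: mult_ac)
  then show ?thesis
    by (rule has_field_derivative_transform_within_open[OF _ open_upper_half_plane])
       (use assms in \<open>auto simp: q_series_def\<close>)
qed

text \<open>In terms of the nome \<open>q\<close> of width \<open>w\<close>, differentiation by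
  \<tau> is \<open>2 * pi * \<i> / w\<close> times the operator q d/dq.\<close>

lemma q_series_deriv:
  assumes "q_series w F L" "w > 0"
  shows "q_series w (deriv F) (fls_const (2 * of_real pi * \<i> / of_nat w) * (fls_X * fls_deriv L))"
proof -
  have r: "1 \<le> fls_conv_radius (fls_deriv L)" "1 \<le> fls_conv_radius (fls_X * fls_deriv L)"
    using assms(1) order.trans[OF _ fls_conv_radius_deriv, of 1 L]
    by (auto simp: q_series_def intro!: fls_conv_radius_mult_ge)
  then have "1 \<le> fls_conv_radius (fls_const (2 * of_real pi * \<i> / of_nat w) * (fls_X * fls_deriv L))"
    by (intro fls_conv_radius_mult_ge) auto
  moreover have "deriv F \<tau> = eval_fls (fls_const (2 * of_real pi * \<i> / of_nat w) * (fls_X * fls_deriv L)) (nome w \<tau>)"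
    if "Im \<tau> > 0" for \<tau>
    using DERIV_imp_deriv[OF q_series_has_field_derivative[OF assms that]] r nome_in_ball[OF assms(2) that]
    by (simp add: eval_fls_mult)
  ultimately show ?thesis by (simp add: q_series_def)
qed

lemma q_series_holomorphic:
  assumes "q_series w F L" "w > 0"
  shows "F holomorphic_on upper_half_plane"
  using q_series_has_field_derivative[OF assms]
  unfolding holomorphic_on_def field_differentiable_def
  by (auto intro: has_field_derivative_at_within)

lemma q_series_periodic:
  assumes "q_series w F L" "w > 0" "Im \<tau> > 0"
  shows "F (\<tau> + of_nat w) = F \<tau>"
  using assms by (simp add: q_series_def nome_add_width)

text \<open>Integrating the quotient of the series by its variable divides the coefficient at
  \<open>n\<close> by \<open>n\<close>, which does not increase its norm for positive
  \<open>n\<close>.\<close>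

lemma fls_conv_radius_integral_ge:
  "fls_conv_radius L \<le> fls_conv_radius (fls_integral (fls_shift 1 L) :: complex fls)"
  unfolding fls_conv_radius_def[of "fls_integral _"] fps_conv_radius_def
proof (rule conv_radius_geI_ex')
  fix r :: real assume r: "0 < r" "ereal r < fls_conv_radius L"
  have "summable (\<lambda>n. norm (fls_nth L (int n) * of_real r ^ n))"
    by (rule norm_summable_fls) (use r in simp)
  then show "summable (\<lambda>n. fps_nth (fls_regpart (fls_integral (fls_shift 1 L))) n * of_real r ^ n)"
  proof (rule summable_comparison_test'[where N = 0])
    fix n :: nat
    have "norm (fls_nth L (int n)) / real n \<le> norm (fls_nth L (int n))" if "n > 0"
      using that by (simp add: pos_divide_le_eq mult_right_le_one_le mult_le_cancel_left1)
    then show "norm (fps_nth (fls_regpart (fls_integral (fls_shift 1 L))) n * of_real r ^ n)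
        \<le> norm (fls_nth L (int n) * of_real r ^ n)"
      using r by (auto simp: norm_mult norm_divide norm_inverse divide_simps intro!: mult_right_mono)
  qed
qed

text \<open>Termwise integration. Every term but the constant one has a periodic primitive, so the
  constant coefficient alone is responsible for the failure of periodicity. This is how the residue
  at a cusp is measured later.\<close>

lemma q_series_primitive:
  assumes "q_series w F L" "w > 0"
  obtains P where "\<And>\<tau>. Im \<tau> > 0 \<Longrightarrow> (P has_field_derivative F \<tau>) (at \<tau>)"
    "\<And>\<tau>. Im \<tau> > 0 \<Longrightarrow> P (\<tau> + of_nat w) = P \<tau> + of_nat w * fls_nth L 0"
proof -
  define I where "I = fls_integral (fls_shift 1 L)"
  define K where "K = fls_X * fls_deriv I"
  \<comment> \<open>\<open>I\<close> has coefficient 0 at exponent 0, so the constant coefficient of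
    \<open>L\<close> is exactly what \<open>K\<close> loses.\<close>
  have eq: "L = fls_const (fls_nth L 0) + K"
    by (rule fls_eqI) (simp add: K_def I_def fls_X_times_conv_shift)
  have rI: "1 \<le> fls_conv_radius I"
    using assms(1) fls_conv_radius_integral_ge[of L] by (auto simp: q_series_def I_def)
  define P0 where "P0 = (\<lambda>\<tau>. eval_fls I (nome w \<tau>))"
  have P0: "q_series w P0 I" using rI by (simp add: q_series_def P0_def)
  define P where "P = (\<lambda>\<tau>. fls_nth L 0 * \<tau> + of_nat w / (2 * of_real pi * \<i>) * P0 \<tau>)"
  show ?thesis
  proof (rule that[of P])
    fix \<tau> assume \<tau>: "Im \<tau> > 0"
    have rD: "1 \<le> fls_conv_radius (fls_deriv I)"
      using rI order.trans[OF _ fls_conv_radius_deriv, of 1 I] by simp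
    then have rK: "1 \<le> fls_conv_radius K" unfolding K_def by (intro fls_conv_radius_mult_ge) auto
    have "eval_fls L (nome w \<tau>) = fls_nth L 0 + eval_fls K (nome w \<tau>)"
      by (subst eq, subst eval_fls_add) (use nome_in_ball[OF assms(2) \<tau>] rK in auto)
    also have "eval_fls K (nome w \<tau>) = nome w \<tau> * eval_fls (fls_deriv I) (nome w \<tau>)"
      unfolding K_def by (subst eval_fls_mult) (use nome_in_ball[OF assms(2) \<tau>] rD in auto)
    finally have F: "F \<tau> = fls_nth L 0 + nome w \<tau> * eval_fls (fls_deriv I) (nome w \<tau>)"
      using assms(1) \<tau> by (simp add: q_series_def)
    show "(P has_field_derivative F \<tau>) (at \<tau>)"
      unfolding P_def F
      by (rule derivative_eq_intros q_series_has_field_derivative[OF P0 assms(2) \<tau>] refl)+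
         (use assms(2) in \<open>simp add: field_simps\<close>)
    show "P (\<tau> + of_nat w) = P \<tau> + of_nat w * fls_nth L 0"
      using q_series_periodic[OF P0 assms(2) \<tau>] by (simp add: P_def algebra_simps)
  qed
qed

text \<open>By the next two lemmas, an expansion at a cusp amounts to periodicity and a growth bound;
  these, unlike expansions with differing widths, are easy to add and multiply.\<close>

lemma q_series_bound:
  assumes "q_series w F L" "w > 0" "\<And>n. n < M \<Longrightarrow> fls_nth L n = 0" "Y > 0"
  obtains C where "\<And>\<tau>. Im \<tau> \<ge> Y \<Longrightarrow> norm (F \<tau>) \<le> C * exp (- 2 * pi * real_of_int M / real w * Im \<tau>)"
proof -
  define K where "K = fls_shift M L"
  have K0: "fls_subdegree K \<ge> 0"
    by (rule fls_subdegree_ge0I) (simp add: K_def assms(3))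
  have rK: "1 \<le> fls_conv_radius K" using assms(1) by (simp add: K_def q_series_def)
  define r where "r = exp (- 2 * pi * Y / real w)"
  have r: "r < 1" using assms by (simp add: r_def)
  have "ereal (norm z) < fls_conv_radius K" if "norm z \<le> r" for z :: complex
    using that r rK by (metis ereal_less(3) le_less_trans less_le_trans)
  then have "continuous_on (cball 0 r) (eval_fls K)"
    using K0 by (intro holomorphic_on_imp_continuous_on holomorphic_on_eval_fls) auto
  then have "bounded (eval_fls K ` cball 0 r)"
    by (intro compact_imp_bounded compact_continuous_image) auto
  then obtain C where "\<forall>z\<in>cball 0 r. norm (eval_fls K z) \<le> C"
    unfolding bounded_iff by auto
  then have C: "norm (eval_fls K z) \<le> C" if "norm z \<le> r" for z using that by simp
  show ?thesis
  proof (rule that[of C])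
    fix \<tau> assume \<tau>: "Im \<tau> \<ge> Y"
    define z where "z = nome w \<tau>"
    have nz: "norm z \<le> r" using \<tau> assms(2) by (simp add: z_def r_def norm_nome divide_right_mono)
    have "F \<tau> = eval_fls L z" using assms(1,4) \<tau> by (simp add: z_def q_series_def)
    also have "\<dots> = eval_fls K z * z powi M"
      by (simp add: K_def eval_fls_shift z_def flip: power_int_add)
    finally have "norm (F \<tau>) = norm (eval_fls K z) * norm z powi M"
      by (simp add: norm_mult norm_power_int)
    also have "norm z powi M = exp (- 2 * pi * real_of_int M / real w * Im \<tau>)"
      by (simp add: z_def norm_nome exp_power_int mult_ac)
    also have "norm (eval_fls K z) * exp (- 2 * pi * real_of_int M / real w * Im \<tau>)
        \<le> C * exp (- 2 * pi * real_of_int M / real w * Im \<tau>)"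
      by (intro mult_right_mono C nz) auto
    finally show "norm (F \<tau>) \<le> C * exp (- 2 * pi * real_of_int M / real w * Im \<tau>)" .
  qed
qed

lemma q_series_exists:
  assumes hol: "F holomorphic_on upper_half_plane" and w: "w > 0"
    and per: "\<And>\<tau>. Im \<tau> > 0 \<Longrightarrow> F (\<tau> + of_nat w) = F \<tau>"
    and bound: "\<And>\<tau>. Im \<tau> > 0 \<Longrightarrow> Im \<tau> \<ge> Y \<Longrightarrow>
      norm (F \<tau>) \<le> C * exp (- 2 * pi * real_of_int M / real w * Im \<tau>)"
  obtains L where "q_series w F L" "\<And>n. n < M \<Longrightarrow> fls_nth L n = 0"
proof -
  define \<kappa> where "\<kappa> = of_nat w / (2 * of_real pi * \<i> :: complex)"
  define \<Phi> where "\<Phi> = (\<lambda>z. F (\<kappa> * Ln z))"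
  have Im\<kappa>: "nome w (\<kappa> * u) = z \<and> Im (\<kappa> * u) > 0" if "exp u = z" "norm z < 1" for u z
    using nome_Ln[OF w that] by (simp add: \<kappa>_def)
  have "\<Phi> holomorphic_on ball 0 1 - {0}"
    unfolding holomorphic_on_def
  proof
    fix z0 :: complex assume z0: "z0 \<in> ball 0 1 - {0}"
    \<comment> \<open>\<open>Ln\<close> has a cut. Near \<open>z0\<close> it is replaced by the
      branch \<open>Ln (z / z0) + Ln z0\<close>, and periodicity of \<open>F\<close> makes both
      branches give the same value.\<close>
    define U where "U = (ball 0 1 - {0}) \<inter> {z. z / z0 \<in> - \<real>\<^sub>\<le>\<^sub>0}"
    have "open ((\<lambda>z. z / z0) -` (- \<real>\<^sub>\<le>\<^sub>0))"
      using z0 by (intro open_vimage continuous_intros) (auto simp: closed_def[symmetric])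
    then have "open U" unfolding U_def vimage_def by (intro open_Int open_Diff) auto
    have "z0 \<in> U" using z0 by (simp add: U_def)
    have exp: "exp (Ln (z / z0) + Ln z0) = z" if "z \<in> U" for z
      using that z0 by (simp add: U_def exp_add)
    have "(F \<circ> (\<lambda>z. \<kappa> * (Ln (z / z0) + Ln z0))) holomorphic_on U"
    proof (rule holomorphic_on_compose_gen[OF _ hol])
      show "(\<lambda>z. \<kappa> * (Ln (z / z0) + Ln z0)) holomorphic_on U"
        by (intro holomorphic_intros) (use z0 in \<open>auto simp: U_def\<close>)
      show "(\<lambda>z. \<kappa> * (Ln (z / z0) + Ln z0)) ` U \<subseteq> upper_half_plane"
        using Im\<kappa>[OF exp] by (auto simp: U_def)
    qed
    moreover have "(F \<circ> (\<lambda>z. \<kappa> * (Ln (z / z0) + Ln z0))) z = \<Phi> z" if "z \<in> U" for z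
    proof -
      have "z \<noteq> 0" "norm z < 1" using that by (auto simp: U_def)
      then show ?thesis
        using Im\<kappa>[OF exp[OF that]] Im\<kappa>[OF exp_Ln[of z]] periodic_nome_eq[of F, OF per w]
        by (simp add: \<Phi>_def)
    qed
    ultimately have "\<Phi> holomorphic_on U" by (rule holomorphic_transform)
    then have "\<Phi> field_differentiable (at z0)"
      using \<open>open U\<close> \<open>z0 \<in> U\<close> holomorphic_on_imp_differentiable_at by blast
    then show "\<Phi> field_differentiable (at z0 within ball 0 1 - {0})"
      by (rule field_differentiable_at_within)
  qed
  \<comment> \<open>Dividing by \<open>z powi M\<close> turns the growth bound into boundedness near
    0, so that the singularity is removable.\<close>
  define \<phi> where "\<phi> = (\<lambda>z. \<Phi> z * z powi (- M))"
  have hol\<phi>: "\<phi> holomorphic_on ball 0 1 - {0}"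
    unfolding \<phi>_def by (intro holomorphic_intros \<open>\<Phi> holomorphic_on ball 0 1 - {0}\<close>) auto
  have F\<Phi>: "F \<tau> = \<Phi> (nome w \<tau>)" if "Im \<tau> > 0" for \<tau>
    unfolding \<Phi>_def using Im\<kappa>[OF exp_Ln[of "nome w \<tau>"] norm_nome_less_1[OF w that]]
    by (intro periodic_nome_eq[of F, OF per w]) (use that in auto)
  define r where "r = exp (- 2 * pi * Y / real w)"
  have bd: "norm (\<phi> z) \<le> C" if z: "z \<noteq> 0" "norm z < 1" "norm z \<le> r" for z
  proof -
    obtain \<tau> where \<tau>: "Im \<tau> > 0" "nome w \<tau> = z" using nome_surj[OF w z(1,2)] .
    have "norm z = exp (- 2 * pi * Im \<tau> / real w)" using \<tau>(2) norm_nome by metis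
    then have "- 2 * pi * Im \<tau> / real w \<le> - 2 * pi * Y / real w" using z(3) by (simp add: r_def)
    then have "Im \<tau> \<ge> Y" using w by (simp add: field_simps)
    then have "norm (F \<tau>) \<le> C * exp (- 2 * pi * real_of_int M / real w * Im \<tau>)" using bound \<tau>(1) by blast
    also have "exp (- 2 * pi * real_of_int M / real w * Im \<tau>) = norm z powi M"
      by (simp add: norm_nome exp_power_int mult_ac flip: \<tau>(2))
    finally have "norm (\<Phi> z) \<le> C * norm z powi M" using F\<Phi>[OF \<tau>(1)] \<tau>(2) by simp
    then show ?thesis
      using z(1) by (simp add: \<phi>_def norm_divide norm_power_int power_int_minus pos_divide_le_eq
          flip: divide_inverse)
  qed
  have "eventually (\<lambda>z. norm (\<phi> z) \<le> C) (at 0)"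
    unfolding eventually_at
    by (intro exI[of _ "min 1 r"]) (use bd in \<open>auto simp: r_def\<close>)
  then obtain g where g: "g holomorphic_on ball 0 1" "\<And>z. z \<in> ball 0 1 - {0} \<Longrightarrow> g z = \<phi> z"
    using holomorphic_on_extend_bounded[OF hol\<phi>] by auto
  define p where "p = fps_expansion g 0"
  have g': "g holomorphic_on eball 0 1" using g(1) by (simp add: one_ereal_def)
  have rp: "1 \<le> fps_conv_radius p" unfolding p_def using conv_radius_fps_expansion[OF g'] .
  have ep: "eval_fps p z = g z" if "norm z < 1" for z
    using eval_fps_expansion'[OF g', of z] that by (simp add: p_def one_ereal_def)
  show ?thesis
  proof (rule that[of "fls_shift (- M) (fps_to_fls p)"])
    have "F \<tau> = eval_fls (fls_shift (- M) (fps_to_fls p)) (nome w \<tau>)" if \<tau>: "Im \<tau> > 0" for \<tau>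
    proof -
      define z where "z = nome w \<tau>"
      have z: "z \<noteq> 0" "norm z < 1" by (auto simp: z_def norm_nome_less_1 w \<tau>)
      then have "ereal (norm z) < fps_conv_radius p"
        using rp by (metis ereal_less(3) less_le_trans)
      then have "eval_fls (fls_shift (- M) (fps_to_fls p)) z = \<phi> z * z powi M"
        using z by (simp add: eval_fls_shift eval_fps_to_fls ep g(2))
      also have "\<dots> = \<Phi> z" using z by (simp add: \<phi>_def flip: power_int_add)
      finally show ?thesis using F\<Phi>[OF \<tau>] by (simp add: z_def)
    qed
    then show "q_series w F (fls_shift (- M) (fps_to_fls p))" using rp by (simp add: q_series_def)
  qed simp
qed

text \<open>Order at least \<open>M\<close> at width \<open>w\<close> corresponds to
  \<open>K = - 2 * pi * M / w\<close>. A real exponent is independent of the choice of the width: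
  \<open>K = 0\<close> expresses holomorphy at the cusp and negative \<open>K\<close>
  vanishing.\<close>

definition cusp_growth :: "real \<Rightarrow> (complex \<Rightarrow> complex) \<Rightarrow> bool" where
  "cusp_growth K G \<longleftrightarrow> G holomorphic_on upper_half_plane
     \<and> (\<exists>w>0. \<forall>\<tau>. Im \<tau> > 0 \<longrightarrow> G (\<tau> + of_nat w) = G \<tau>)
     \<and> (\<exists>C Y. \<forall>\<tau>. Im \<tau> > 0 \<longrightarrow> Im \<tau> \<ge> Y \<longrightarrow> norm (G \<tau>) \<le> C * exp (K * Im \<tau>))"

lemma cusp_growth_mono:
  assumes "cusp_growth K F" "K \<le> K'"
  shows "cusp_growth K' F"
proof -
  obtain C Y where C: "\<And>\<tau>. Im \<tau> > 0 \<Longrightarrow> Im \<tau> \<ge> Y \<Longrightarrow> norm (F \<tau>) \<le> C * exp (K * Im \<tau>)"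
    using assms(1) unfolding cusp_growth_def by blast
  have "norm (F \<tau>) \<le> \<bar>C\<bar> * exp (K' * Im \<tau>)" if "Im \<tau> > 0" "Im \<tau> \<ge> Y" for \<tau>
  proof -
    have "C * exp (K * Im \<tau>) \<le> \<bar>C\<bar> * exp (K' * Im \<tau>)"
      using assms(2) that by (intro mult_mono) (auto intro!: mult_right_mono)
    then show ?thesis using C[OF that] by simp
  qed
  then show ?thesis using assms(1) unfolding cusp_growth_def by blast
qed

lemma cusp_growth_common_width:
  assumes "cusp_growth K F" "cusp_growth K' G"
  obtains w where "w > 0" "\<And>\<tau>. Im \<tau> > 0 \<Longrightarrow> F (\<tau> + of_nat w) = F \<tau>"
    "\<And>\<tau>. Im \<tau> > 0 \<Longrightarrow> G (\<tau> + of_nat w) = G \<tau>"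
proof -
  obtain w1 where w1: "w1 > 0" "\<And>\<tau>. Im \<tau> > 0 \<Longrightarrow> F (\<tau> + of_nat w1) = F \<tau>"
    using assms(1) unfolding cusp_growth_def by blast
  obtain w2 where w2: "w2 > 0" "\<And>\<tau>. Im \<tau> > 0 \<Longrightarrow> G (\<tau> + of_nat w2) = G \<tau>"
    using assms(2) unfolding cusp_growth_def by blast
  show ?thesis
  proof (rule that[of "w1 * w2"])
    show "F (\<tau> + of_nat (w1 * w2)) = F \<tau>" if "Im \<tau> > 0" for \<tau>
      using periodic_int_multiple[of F w1 \<tau> "int w2", OF w1(2) that] by (simp add: mult.commute)
    show "G (\<tau> + of_nat (w1 * w2)) = G \<tau>" if "Im \<tau> > 0" for \<tau>
      using periodic_int_multiple[of G w2 \<tau> "int w1", OF w2(2) that] by simp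
  qed (use w1 w2 in simp)
qed

lemma cusp_growth_add:
  assumes "cusp_growth K F" "cusp_growth K G"
  shows "cusp_growth K (\<lambda>\<tau>. F \<tau> + G \<tau>)"
proof -
  obtain w where "w > 0" "\<And>\<tau>. Im \<tau> > 0 \<Longrightarrow> F (\<tau> + of_nat w) = F \<tau>"
    "\<And>\<tau>. Im \<tau> > 0 \<Longrightarrow> G (\<tau> + of_nat w) = G \<tau>"
    using cusp_growth_common_width[OF assms] by blast
  then have w: "\<exists>w>0. \<forall>\<tau>. Im \<tau> > 0 \<longrightarrow> F (\<tau> + of_nat w) + G (\<tau> + of_nat w) = F \<tau> + G \<tau>"
    by (intro exI[of _ w]) simp
  obtain C Y where C: "\<And>\<tau>. Im \<tau> > 0 \<Longrightarrow> Im \<tau> \<ge> Y \<Longrightarrow> norm (F \<tau>) \<le> C * exp (K * Im \<tau>)"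
    using assms(1) unfolding cusp_growth_def by blast
  obtain C' Y' where C': "\<And>\<tau>. Im \<tau> > 0 \<Longrightarrow> Im \<tau> \<ge> Y' \<Longrightarrow> norm (G \<tau>) \<le> C' * exp (K * Im \<tau>)"
    using assms(2) unfolding cusp_growth_def by blast
  have "norm (F \<tau> + G \<tau>) \<le> (C + C') * exp (K * Im \<tau>)" if "Im \<tau> > 0" "Im \<tau> \<ge> max Y Y'" for \<tau>
    using that C[of \<tau>] C'[of \<tau>] norm_triangle_ineq[of "F \<tau>" "G \<tau>"] by (simp add: distrib_right)
  then show ?thesis
    using w assms unfolding cusp_growth_def by (blast intro: holomorphic_on_add)
qed

lemma cusp_growth_mult:
  assumes "cusp_growth K F" "cusp_growth K' G"
  shows "cusp_growth (K + K') (\<lambda>\<tau>. F \<tau> * G \<tau>)"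
proof -
  obtain w where "w > 0" "\<And>\<tau>. Im \<tau> > 0 \<Longrightarrow> F (\<tau> + of_nat w) = F \<tau>"
    "\<And>\<tau>. Im \<tau> > 0 \<Longrightarrow> G (\<tau> + of_nat w) = G \<tau>"
    using cusp_growth_common_width[OF assms] by blast
  then have w: "\<exists>w>0. \<forall>\<tau>. Im \<tau> > 0 \<longrightarrow> F (\<tau> + of_nat w) * G (\<tau> + of_nat w) = F \<tau> * G \<tau>"
    by (intro exI[of _ w]) simp
  obtain C Y where C: "\<And>\<tau>. Im \<tau> > 0 \<Longrightarrow> Im \<tau> \<ge> Y \<Longrightarrow> norm (F \<tau>) \<le> C * exp (K * Im \<tau>)"
    using assms(1) unfolding cusp_growth_def by blast
  obtain C' Y' where C': "\<And>\<tau>. Im \<tau> > 0 \<Longrightarrow> Im \<tau> \<ge> Y' \<Longrightarrow> norm (G \<tau>) \<le> C' * exp (K' * Im \<tau>)"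
    using assms(2) unfolding cusp_growth_def by blast
  have "norm (F \<tau> * G \<tau>) \<le> (C * C') * exp ((K + K') * Im \<tau>)" if "Im \<tau> > 0" "Im \<tau> \<ge> max Y Y'" for \<tau>
  proof -
    have "norm (F \<tau>) * norm (G \<tau>) \<le> (C * exp (K * Im \<tau>)) * (C' * exp (K' * Im \<tau>))"
      using that C[of \<tau>] C'[of \<tau>] by (intro mult_mono) (auto intro: order.trans[OF norm_ge_zero])
    then show ?thesis by (simp add: norm_mult exp_add ring_distribs mult_ac)
  qed
  then show ?thesis
    using w assms unfolding cusp_growth_def by (blast intro: holomorphic_on_mult)
qed

lemma cusp_growth_const: "cusp_growth 0 (\<lambda>\<tau>. c)"
  unfolding cusp_growth_def by (auto intro!: exI[of _ 1] exI[of _ "norm c"])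

lemma q_series_imp_cusp_growth:
  assumes "q_series w F L" "w > 0" "\<And>n. n < M \<Longrightarrow> fls_nth L n = 0"
  shows "cusp_growth (- 2 * pi * real_of_int M / real w) F"
proof -
  obtain C where "\<And>\<tau>. Im \<tau> \<ge> 1 \<Longrightarrow> norm (F \<tau>) \<le> C * exp (- 2 * pi * real_of_int M / real w * Im \<tau>)"
    using q_series_bound[OF assms zero_less_one] by blast
  then show ?thesis
    using q_series_holomorphic[OF assms(1,2)] q_series_periodic[OF assms(1,2)] assms(2)
    unfolding cusp_growth_def by blast
qed

lemma cusp_growth_imp_q_series:
  assumes "cusp_growth K F" "K \<le> 0"
  obtains w L where "w > 0" "q_series w F L" "\<And>n. n < 0 \<Longrightarrow> fls_nth L n = 0"
    "K < 0 \<Longrightarrow> fls_nth L 0 = 0"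
proof -
  obtain w where w: "w > 0" "\<And>\<tau>. Im \<tau> > 0 \<Longrightarrow> F (\<tau> + of_nat w) = F \<tau>"
    using assms(1) unfolding cusp_growth_def by blast
  define M :: int where "M = (if K < 0 then 1 else 0)"
  \<comment> \<open>The decay rate \<open>- K\<close> may be less than \<open>2 * pi / w\<close>,
    the rate of the first power of the nome. Passing to the width \<open>w * k\<close> makes that
    rate small enough to fit below it.\<close>
  obtain k :: nat where k: "k > 0" "K < 0 \<Longrightarrow> 2 * pi / (real w * real k) \<le> - K"
  proof (cases "K < 0")
    case True
    have pos: "real w * (- K) > 0" using True w by (intro mult_pos_pos) auto
    obtain k :: nat where k: "real k > 2 * pi / (real w * (- K))" using reals_Archimedean2 by blast
    moreover have "2 * pi / (real w * (- K)) > 0" using pos by (intro divide_pos_pos) auto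
    ultimately have "k > 0" by (intro Nat.gr0I) auto
    have "2 * pi < real k * (real w * (- K))" using k pos by (simp only: pos_divide_less_eq)
    also have "\<dots> = - K * (real w * real k)" by simp
    finally have "2 * pi \<le> - K * (real w * real k)" by simp
    then have "2 * pi / (real w * real k) \<le> - K"
      using \<open>k > 0\<close> w(1) by (subst pos_divide_le_eq) auto
    then show ?thesis using that \<open>k > 0\<close> by blast
  qed (auto intro: that[of 1])
  have M: "K \<le> - 2 * pi * real_of_int M / real (w * k)" using k assms(2) by (auto simp: M_def)
  from cusp_growth_mono[OF assms(1) M] obtain C Y where
    C: "\<And>\<tau>. Im \<tau> > 0 \<Longrightarrow> Im \<tau> \<ge> Y \<Longrightarrow> norm (F \<tau>) \<le> C * exp (- 2 * pi * real_of_int M / real (w * k) * Im \<tau>)"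
    unfolding cusp_growth_def by blast
  have per: "F (\<tau> + of_nat (w * k)) = F \<tau>" if "Im \<tau> > 0" for \<tau>
    using periodic_int_multiple[of F w \<tau> "int k", OF w(2) that] by (simp add: mult.commute)
  have hol: "F holomorphic_on upper_half_plane" using assms(1) by (simp add: cusp_growth_def)
  have wk: "w * k > 0" using w k by simp
  obtain L where "q_series (w * k) F L" "\<And>n. n < M \<Longrightarrow> fls_nth L n = 0"
    by (rule q_series_exists[where Y = Y, OF hol wk per C]) (assumption | rule that)+
  then show ?thesis using that[OF wk] by (auto simp: M_def split: if_splits)
qed

lemma order_at_cusp_ge_imp_q_series:
  assumes "order_at_cusp_ge k \<gamma> F M"
  obtains w L where "w > 0" "q_series w (slash k \<gamma> F) L" "\<And>n. n < M \<Longrightarrow> fls_nth L n = 0"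
proof -
  obtain w c where "w > 0" "has_q_expansion w (slash k \<gamma> F) c" "\<forall>n<M. c n = 0"
    using assms unfolding order_at_cusp_ge_def by blast
  moreover from this have "fls_nth (Abs_fls c) = c"
    by (intro ext nth_Abs_fls_lower_bound[of M]) auto
  ultimately show ?thesis using that[of w "Abs_fls c"] has_q_expansion_imp_q_series[of w _ c M] by auto
qed

lemma order_at_cusp_ge_iff_cusp_growth:
  "order_at_cusp_ge k \<gamma> F 0 \<longleftrightarrow> cusp_growth 0 (slash k \<gamma> F)"
proof
  assume "order_at_cusp_ge k \<gamma> F 0"
  then obtain w L where "w > 0" "q_series w (slash k \<gamma> F) L" "\<And>n. n < 0 \<Longrightarrow> fls_nth L n = 0"
    by (rule order_at_cusp_ge_imp_q_series) (rule that)
  then show "cusp_growth 0 (slash k \<gamma> F)" using q_series_imp_cusp_growth[of w _ L 0] by simp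
next
  assume "cusp_growth 0 (slash k \<gamma> F)"
  then obtain w L where w: "w > 0" "q_series w (slash k \<gamma> F) L" "\<And>n. n < 0 \<Longrightarrow> fls_nth L n = 0"
    by (rule cusp_growth_imp_q_series[OF _ order.refl]) (rule that)
  then show "order_at_cusp_ge k \<gamma> F 0"
    unfolding order_at_cusp_ge_def
    by (intro exI[of _ w] exI[of _ "fls_nth L"] conjI q_series_imp_has_q_expansion) auto
qed

lemma order_at_cusp_bounded_iff_cusp_growth:
  "(\<exists>M. order_at_cusp_ge k \<gamma> F M) \<longleftrightarrow> (\<exists>K. cusp_growth K (slash k \<gamma> F))"
proof
  assume "\<exists>M. order_at_cusp_ge k \<gamma> F M"
  then obtain M where "order_at_cusp_ge k \<gamma> F M" by blast
  then obtain w L where "w > 0" "q_series w (slash k \<gamma> F) L" "\<And>n. n < M \<Longrightarrow> fls_nth L n = 0"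
    by (rule order_at_cusp_ge_imp_q_series) (rule that)
  then show "\<exists>K. cusp_growth K (slash k \<gamma> F)" using q_series_imp_cusp_growth[of w _ L M] by blast
next
  assume "\<exists>K. cusp_growth K (slash k \<gamma> F)"
  then obtain K where K: "cusp_growth K (slash k \<gamma> F)" by blast
  define G where "G = slash k \<gamma> F"
  obtain w where w: "w > 0" "\<And>\<tau>. Im \<tau> > 0 \<Longrightarrow> G (\<tau> + of_nat w) = G \<tau>"
    using K unfolding cusp_growth_def G_def by blast
  define M where "M = - \<lceil>K * real w / (2 * pi)\<rceil>"
  have "K * real w / (2 * pi) \<le> - real_of_int M" by (simp add: M_def)
  then have "K \<le> - 2 * pi * real_of_int M / real w" using w(1) by (simp add: field_simps)
  from cusp_growth_mono[OF K this] obtain C Y where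
    C: "\<And>\<tau>. Im \<tau> > 0 \<Longrightarrow> Im \<tau> \<ge> Y \<Longrightarrow> norm (G \<tau>) \<le> C * exp (- 2 * pi * real_of_int M / real w * Im \<tau>)"
    unfolding cusp_growth_def G_def by blast
  have hol: "G holomorphic_on upper_half_plane" using K by (simp add: cusp_growth_def G_def)
  obtain L where L: "q_series w G L" "\<And>n. n < M \<Longrightarrow> fls_nth L n = 0"
    by (rule q_series_exists[where Y = Y, OF hol w C]) (assumption | rule that)+
  then show "\<exists>M. order_at_cusp_ge k \<gamma> F M"
    unfolding order_at_cusp_ge_def G_def
    by (intro exI[of _ M] exI[of _ w] exI[of _ "fls_nth L"] conjI q_series_imp_has_q_expansion) (use w in auto)
qed

section \<open>The algebra of functions with poles only at infinity\<close>

lemma M0_infty_iff: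
  "F \<in> M0_infty \<Gamma> \<longleftrightarrow> F holomorphic_on upper_half_plane
     \<and> (\<forall>\<gamma>\<in>\<Gamma>. \<forall>\<tau>. Im \<tau> > 0 \<longrightarrow> slash 0 \<gamma> F \<tau> = F \<tau>)
     \<and> (\<forall>\<gamma>\<in>SL2Z. \<exists>K. cusp_growth K (slash 0 \<gamma> F))
     \<and> (\<forall>\<gamma>\<in>SL2Z. other_cusp \<Gamma> \<gamma> \<longrightarrow> cusp_growth 0 (slash 0 \<gamma> F))"
  by (simp add: M0_infty_def weakly_holomorphic_forms_def order_at_cusp_ge_iff_cusp_growth
      order_at_cusp_bounded_iff_cusp_growth)

lemma M0_infty_const: "(\<lambda>\<tau>. c) \<in> M0_infty \<Gamma>"
  using cusp_growth_const by (auto simp: M0_infty_iff slash_def[abs_def])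

lemma M0_infty_add:
  assumes F: "F \<in> M0_infty \<Gamma>" and G: "G \<in> M0_infty \<Gamma>"
  shows "(\<lambda>\<tau>. F \<tau> + G \<tau>) \<in> M0_infty \<Gamma>"
proof -
  have eq: "slash 0 \<gamma> (\<lambda>\<tau>. F \<tau> + G \<tau>) = (\<lambda>\<tau>. slash 0 \<gamma> F \<tau> + slash 0 \<gamma> G \<tau>)" for \<gamma>
    by (simp add: slash_def fun_eq_iff)
  show ?thesis
    unfolding M0_infty_iff eq
  proof (intro conjI ballI allI impI)
    fix \<gamma> assume "\<gamma> \<in> SL2Z"
    then obtain K K' where K: "cusp_growth K (slash 0 \<gamma> F)" and K': "cusp_growth K' (slash 0 \<gamma> G)"
      using F[unfolded M0_infty_iff] G[unfolded M0_infty_iff] by meson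
    show "\<exists>K. cusp_growth K (\<lambda>\<tau>. slash 0 \<gamma> F \<tau> + slash 0 \<gamma> G \<tau>)"
      by (intro exI[of _ "max K K'"] cusp_growth_add cusp_growth_mono[OF K] cusp_growth_mono[OF K']) auto
  qed (use F G in \<open>simp_all add: M0_infty_iff cusp_growth_add holomorphic_on_add\<close>)
qed

lemma M0_infty_mult:
  assumes F: "F \<in> M0_infty \<Gamma>" and G: "G \<in> M0_infty \<Gamma>"
  shows "(\<lambda>\<tau>. F \<tau> * G \<tau>) \<in> M0_infty \<Gamma>"
proof -
  have eq: "slash 0 \<gamma> (\<lambda>\<tau>. F \<tau> * G \<tau>) = (\<lambda>\<tau>. slash 0 \<gamma> F \<tau> * slash 0 \<gamma> G \<tau>)" for \<gamma>
    by (simp add: slash_def fun_eq_iff)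
  show ?thesis
    unfolding M0_infty_iff eq
  proof (intro conjI ballI allI impI)
    fix \<gamma> assume "\<gamma> \<in> SL2Z"
    then obtain K K' where K: "cusp_growth K (slash 0 \<gamma> F)" and K': "cusp_growth K' (slash 0 \<gamma> G)"
      using F[unfolded M0_infty_iff] G[unfolded M0_infty_iff] by meson
    show "\<exists>K. cusp_growth K (\<lambda>\<tau>. slash 0 \<gamma> F \<tau> * slash 0 \<gamma> G \<tau>)"
      using cusp_growth_mult[OF K K'] by blast
  next
    fix \<gamma> assume "\<gamma> \<in> SL2Z" "other_cusp \<Gamma> \<gamma>"
    then show "cusp_growth 0 (\<lambda>\<tau>. slash 0 \<gamma> F \<tau> * slash 0 \<gamma> G \<tau>)"
      using cusp_growth_mult[of 0 "slash 0 \<gamma> F" 0 "slash 0 \<gamma> G"] F G by (simp add: M0_infty_iff)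
  qed (use F G in \<open>simp_all add: M0_infty_iff holomorphic_on_mult\<close>)
qed

lemma M0_infty_sum:
  assumes "\<And>i. i \<in> I \<Longrightarrow> F i \<in> M0_infty \<Gamma>"
  shows "(\<lambda>\<tau>. \<Sum>i\<in>I. F i \<tau>) \<in> M0_infty \<Gamma>"
  using assms
  by (induction I rule: infinite_finite_induct) (simp_all add: M0_infty_add M0_infty_const)

lemma bounded_by_exponential_decay:
  fixes a C :: real
  assumes "\<And>y. y \<ge> 1 \<Longrightarrow> a \<le> C * exp (- 2 * pi * y)"
  shows "a \<le> 0"
proof (rule tendsto_lowerbound)
  show "((\<lambda>y. C * exp (- 2 * pi * y)) \<longlongrightarrow> 0) at_top"
    by (intro tendsto_mult_right_zero filterlim_compose[OF exp_at_bot]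
        filterlim_tendsto_neg_mult_at_bot[OF tendsto_const _ filterlim_ident]) simp
  show "\<forall>\<^sub>F y in at_top. a \<le> C * exp (- 2 * pi * y)"
    using eventually_ge_at_top[of 1] by (rule eventually_mono) (rule assms)
qed (rule trivial_limit_at_top_linorder)
section \<open>Functions without poles\<close>

lemma coset_function_eq: "Im \<tau> > 0 \<Longrightarrow> coset_function k F \<gamma> \<tau> = slash k \<gamma> F \<tau>"
  by (simp add: coset_function_def)

text \<open>The maximum modulus principle applied to the finitely many expansions of F at the cusps.\<close>

theorem M0_infty_vanishing:
  assumes N: "N > 0" and \<Gamma>: "Gamma0 N \<subseteq> \<Gamma>" "\<And>\<gamma>. \<gamma> \<in> \<Gamma> \<Longrightarrow> det \<gamma> = 1"
    and F: "F \<in> M0_infty \<Gamma>" and L: "q_series 1 F L" "\<And>n. n \<le> 0 \<Longrightarrow> fls_nth L n = 0"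
    and \<tau>: "Im \<tau> > 0"
  shows "F \<tau> = 0"
proof -
  have inv: "slash 0 \<gamma> F \<tau> = F \<tau>" if "\<gamma> \<in> \<Gamma>" "Im \<tau> > 0" for \<gamma> \<tau>
    using F that by (simp add: M0_infty_iff)
  have growth: "cusp_growth 0 (slash 0 \<gamma> F)" if \<gamma>: "\<gamma> \<in> SL2Z" for \<gamma>
  proof (cases "other_cusp \<Gamma> \<gamma>")
    case True
    then show ?thesis using F \<gamma> by (simp add: M0_infty_iff)
  next
    case False
    obtain \<alpha> \<beta> :: real where "\<alpha> \<noteq> 0"
      and eq: "\<And>\<tau>. Im \<tau> > 0 \<Longrightarrow> slash 0 \<gamma> F \<tau> = of_real (\<alpha> ^ 0) * F (of_real (\<alpha>\<^sup>2) * \<tau> + of_real \<beta>)"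
      using cusp_equivalent_to_infinity[OF \<Gamma>(2) \<gamma> False inv] by blast
    have pos: "\<alpha>\<^sup>2 > 0" using \<open>\<alpha> \<noteq> 0\<close> by simp
    \<comment> \<open>The bound is taken from height \<open>\<alpha>\<^sup>2\<close> on because the
      substitution maps heights above 1 to heights above \<open>\<alpha>\<^sup>2\<close>.\<close>
    obtain C where C: "\<And>\<tau>. Im \<tau> \<ge> \<alpha>\<^sup>2 \<Longrightarrow> norm (F \<tau>) \<le> C * exp (- 2 * pi * real_of_int 0 / real 1 * Im \<tau>)"
      using q_series_bound[OF L(1) _ _ pos, of 0] L(2) by auto
    obtain K where K: "cusp_growth K (slash 0 \<gamma> F)" using F \<gamma> by (auto simp: M0_infty_iff)
    have "norm (slash 0 \<gamma> F \<tau>) \<le> C * exp (0 * Im \<tau>)" if "Im \<tau> > 0" "Im \<tau> \<ge> 1" for \<tau>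
      using eq[OF that(1)] C[of "of_real (\<alpha>\<^sup>2) * \<tau> + of_real \<beta>"] pos that by simp
    then show ?thesis using K unfolding cusp_growth_def by blast
  qed
  define \<F> where "\<F> = coset_function 0 F ` SL2Z"
  have fin: "finite \<F>" unfolding \<F>_def
    by (rule finite_coset_functions[OF N]) (rule inv[OF subsetD[OF \<Gamma>(1)]])
  have ne: "\<F> \<noteq> {}" using SL2Z_one by (auto simp: \<F>_def)
  have "\<exists>w L. w > 0 \<and> q_series w G L \<and> (\<forall>n<0. fls_nth L n = 0)" if G: "G \<in> \<F>" for G
  proof -
    obtain \<gamma> where \<gamma>: "\<gamma> \<in> SL2Z" "G = coset_function 0 F \<gamma>" using G unfolding \<F>_def by (elim imageE)
    obtain w L where "w > 0" "q_series w (slash 0 \<gamma> F) L" "\<And>n. n < 0 \<Longrightarrow> fls_nth L n = 0"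
      by (rule cusp_growth_imp_q_series[OF growth[OF \<gamma>(1)] order.refl]) (rule that)
    moreover from this(2) have "q_series w G L"
      by (rule q_series_cong) (simp add: \<gamma>(2) coset_function_def)
    ultimately show ?thesis by (intro exI[of _ w] exI[of _ L]) simp
  qed
  then obtain w where "\<forall>G\<in>\<F>. \<exists>L. w G > 0 \<and> q_series (w G) G L \<and> (\<forall>n<0. fls_nth L n = 0)"
    using bchoice[of \<F> "\<lambda>G w. \<exists>L. w > 0 \<and> q_series w G L \<and> (\<forall>n<0. fls_nth L n = 0)"] by blast
  then obtain \<Lambda> where "\<forall>G\<in>\<F>. w G > 0 \<and> q_series (w G) G (\<Lambda> G) \<and> (\<forall>n<0. fls_nth (\<Lambda> G) n = 0)"
    using bchoice[of \<F> "\<lambda>G L. w G > 0 \<and> q_series (w G) G L \<and> (\<forall>n<0. fls_nth L n = 0)"] by blast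
  then have w: "\<And>G. G \<in> \<F> \<Longrightarrow> w G > (0::nat)"
    and \<Lambda>: "\<And>G. G \<in> \<F> \<Longrightarrow> q_series (w G) G (\<Lambda> G)" "\<And>G n. G \<in> \<F> \<Longrightarrow> n < 0 \<Longrightarrow> fls_nth (\<Lambda> G) n = 0"
    by simp_all
  \<comment> \<open>\<open>r G\<close> is the norm of the nome at height 1/2, the height reached by
    \<open>SL2Z_reduction\<close>. Thus every value of \<open>F\<close> is taken by the expansion of
    one of these functions on its closed disc of radius \<open>r G\<close>.\<close>
  define r where "r G = exp (- pi / real (w G))" for G
  have r: "r G < 1" if "G \<in> \<F>" for G using w[OF that] by (simp add: r_def)
  have hol: "eval_fls (\<Lambda> G) holomorphic_on ball 0 1" if "G \<in> \<F>" for G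
  proof -
    have "fls_subdegree (\<Lambda> G) \<ge> 0" using \<Lambda>(2)[OF that] by (intro fls_subdegree_ge0I) auto
    moreover have "ereal (norm z) < fls_conv_radius (\<Lambda> G)" if "norm z < 1" for z :: complex
      using \<Lambda>(1)[OF \<open>G \<in> \<F>\<close>] that unfolding q_series_def by (metis ereal_less(3) less_le_trans)
    ultimately show ?thesis by (intro holomorphic_on_eval_fls) auto
  qed
  have "\<exists>z. norm z \<le> r G \<and> (\<forall>y. norm y \<le> r G \<longrightarrow> norm (eval_fls (\<Lambda> G) y) \<le> norm (eval_fls (\<Lambda> G) z))"
    if "G \<in> \<F>" for G
  proof -
    have "continuous_on (cball 0 (r G)) (eval_fls (\<Lambda> G))"
      by (rule continuous_on_subset[OF holomorphic_on_imp_continuous_on[OF hol[OF that]]])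
         (use r[OF that] in auto)
    then have "continuous_on (cball 0 (r G)) (\<lambda>z. norm (eval_fls (\<Lambda> G) z))"
      by (rule continuous_on_norm)
    moreover have "cball (0::complex) (r G) \<noteq> {}" by (simp add: r_def)
    ultimately show ?thesis
      using continuous_attains_sup[of "cball (0::complex) (r G)" "\<lambda>z. norm (eval_fls (\<Lambda> G) z)"]
      by auto
  qed
  then obtain z where "\<forall>G\<in>\<F>. norm (z G) \<le> r G \<and>
      (\<forall>y. norm y \<le> r G \<longrightarrow> norm (eval_fls (\<Lambda> G) y) \<le> norm (eval_fls (\<Lambda> G) (z G)))"
    using bchoice[of \<F> "\<lambda>G z. norm z \<le> r G \<and>
      (\<forall>y. norm y \<le> r G \<longrightarrow> norm (eval_fls (\<Lambda> G) y) \<le> norm (eval_fls (\<Lambda> G) z))"] by blast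
  then have z: "\<And>G. G \<in> \<F> \<Longrightarrow> norm (z G) \<le> r G"
    "\<And>G y. G \<in> \<F> \<Longrightarrow> norm y \<le> r G \<Longrightarrow> norm (eval_fls (\<Lambda> G) y) \<le> norm (eval_fls (\<Lambda> G) (z G))"
    by simp_all
  define m where "m G = norm (eval_fls (\<Lambda> G) (z G))" for G
  have "Max (m ` \<F>) \<in> m ` \<F>" using fin ne by (intro Max_in) auto
  then obtain G where G: "G \<in> \<F>" "m G = Max (m ` \<F>)" by auto
  have max: "m H \<le> m G" if "H \<in> \<F>" for H using fin that unfolding G(2) by (intro Max_ge) auto
  have bound: "norm (F \<tau>) \<le> m G" if "Im \<tau> > 0" for \<tau>
  proof -
    obtain \<gamma> \<sigma> where \<gamma>: "\<gamma> \<in> SL2Z" "Im \<sigma> \<ge> 1/2" "\<tau> = moebius_mat \<gamma> \<sigma>"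
      using SL2Z_reduction[OF \<open>Im \<tau> > 0\<close>] by blast
    define H where "H = coset_function 0 F \<gamma>"
    have H: "H \<in> \<F>" using \<gamma>(1) by (simp add: H_def \<F>_def)
    have "F \<tau> = H \<sigma>" using \<gamma> by (simp add: H_def coset_function_def slash_def)
    also have "\<dots> = eval_fls (\<Lambda> H) (nome (w H) \<sigma>)" using \<Lambda>(1)[OF H] \<gamma>(2) by (simp add: q_series_def)
    also have "norm \<dots> \<le> m H"
    proof -
      have "norm (nome (w H) \<sigma>) \<le> r H"
        using \<gamma>(2) w[OF H] by (simp add: norm_nome r_def divide_right_mono)
      then show ?thesis using z(2)[OF H] by (simp add: m_def)
    qed
    finally show ?thesis using max[OF H] by simp
  qed
  obtain \<gamma> where \<gamma>: "\<gamma> \<in> SL2Z" "G = coset_function 0 F \<gamma>" using G(1) unfolding \<F>_def by (elim imageE)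
  note det = SL2Z_det[OF \<gamma>(1)]
  \<comment> \<open>Away from the centre the values on the unit disc are values of \<open>F\<close>,
    hence bounded by the largest of the maxima. That maximum is attained at \<open>z G\<close>, an
    interior point because \<open>r G < 1\<close>.\<close>
  have "norm (eval_fls (\<Lambda> G) y) \<le> norm (eval_fls (\<Lambda> G) (z G))" if y: "y \<in> ball 0 1" for y
  proof (cases "y = 0")
    case True
    then show ?thesis using z(2)[OF G(1), of 0] by (simp add: r_def)
  next
    case False
    obtain \<sigma> where \<sigma>: "Im \<sigma> > 0" "nome (w G) \<sigma> = y"
      using nome_surj[OF w[OF G(1)] False] y by auto
    have "eval_fls (\<Lambda> G) y = G \<sigma>" using \<Lambda>(1)[OF G(1)] \<sigma> by (auto simp: q_series_def)
    also have "\<dots> = F (moebius_mat \<gamma> \<sigma>)" using \<gamma> \<sigma> by (simp add: coset_function_def slash_def)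
    finally show ?thesis using bound[OF Im_moebius_mat_pos[OF det \<sigma>(1)]] by (simp add: m_def)
  qed
  moreover have "z G \<in> ball 0 1" using z(1)[OF G(1)] r[OF G(1)] by simp
  ultimately have "eval_fls (\<Lambda> G) constant_on ball 0 1"
    by (intro maximum_modulus_principle[OF hol[OF G(1)], of "ball 0 1" "z G"]) auto
  then obtain c where c: "\<And>y. norm y < 1 \<Longrightarrow> eval_fls (\<Lambda> G) y = c"
    unfolding constant_on_def by auto
  have const: "F \<tau> = c" if "Im \<tau> > 0" for \<tau>
  proof -
    define \<sigma> where "\<sigma> = moebius_mat (inverse_2_2 \<gamma>) \<tau>"
    have \<sigma>: "Im \<sigma> > 0" using Im_moebius_mat_pos[of "inverse_2_2 \<gamma>" \<tau>] det that by (simp add: \<sigma>_def)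
    have "F \<tau> = G \<sigma>"
      using moebius_mat_inverse_2_2[OF det that] \<sigma> by (simp add: \<gamma>(2) coset_function_def slash_def \<sigma>_def)
    also have "\<dots> = c"
      using \<Lambda>(1)[OF G(1)] \<sigma> c[OF norm_nome_less_1[OF w[OF G(1)] \<sigma>]] by (simp add: q_series_def)
    finally show ?thesis .
  qed
  obtain C where C: "\<And>\<tau>. Im \<tau> \<ge> 1 \<Longrightarrow> norm (F \<tau>) \<le> C * exp (- 2 * pi * real_of_int 1 / real 1 * Im \<tau>)"
    using q_series_bound[OF L(1) _ _ zero_less_one, of 1] L(2) by auto
  have "norm c \<le> C * exp (- 2 * pi * y)" if "y \<ge> 1" for y :: real
  proof -
    have y: "Im (\<i> * of_real y) = y" by simp
    have "F (\<i> * of_real y) = c" using that by (intro const) (simp add: y)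
    then show ?thesis using C[of "\<i> * of_real y"] that unfolding y by simp
  qed
  then have "norm c \<le> 0" by (rule bounded_by_exponential_decay)
  then show ?thesis using const[OF \<tau>] by simp
qed

section \<open>The residue theorem\<close>

text \<open>\<open>P \<tau> - c * \<tau>\<close> is periodic, hence bounded on a horizontal line, so
  \<open>P\<close> grows along the line with slope \<open>c\<close>. The parameters \<open>s\<close>
  and \<beta> admit the substitution at cusps equivalent to infinity; the step \<open>s\<close> may
  be incommensurable with the period.\<close>

lemma periodic_primitive_mean:
  fixes P :: "complex \<Rightarrow> complex" and s \<beta> :: real
  assumes "w > 0" "s > 0" "continuous_on upper_half_plane P"
    and per: "\<And>\<tau>. Im \<tau> > 0 \<Longrightarrow> P (\<tau> + of_nat w) = P \<tau> + of_nat w * c"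
  shows "(\<lambda>n. P (of_real s * (\<i> + of_nat n) + of_real \<beta>) / of_nat n) \<longlonglongrightarrow> of_real s * c"
proof -
  define E where "E = (\<lambda>\<tau>. P \<tau> - c * \<tau>)"
  have perE: "E (\<tau> + of_nat w) = E \<tau>" if "Im \<tau> > 0" for \<tau>
    using per[OF that] by (simp add: E_def algebra_simps)
  define line where "line x = of_real s * \<i> + of_real x" for x :: real
  have Im_line: "Im (line x) = s" for x by (simp add: line_def)
  have "continuous_on {0..real w} (\<lambda>x. E (line x))"
  proof (rule continuous_on_compose2[of upper_half_plane E])
    show "continuous_on upper_half_plane E" unfolding E_def by (intro continuous_intros assms)
    show "continuous_on {0..real w} line" unfolding line_def by (intro continuous_intros)
  qed (use assms(2) Im_line in auto)
  then have "bounded ((\<lambda>x. E (line x)) ` {0..real w})"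
    by (intro compact_imp_bounded compact_continuous_image) auto
  then obtain B where B: "\<And>x. x \<in> {0..real w} \<Longrightarrow> norm (E (line x)) \<le> B"
    unfolding bounded_iff by blast
  have bd: "norm (E (line x)) \<le> B" for x
  proof -
    define m where "m = \<lfloor>x / real w\<rfloor>"
    have "of_int m \<le> x / real w" "x / real w < of_int m + 1" unfolding m_def by linarith+
    then have "x - of_int m * real w \<in> {0..real w}"
      using assms(1) by (auto simp: field_simps)
    moreover have "E (line x) = E (line (x - of_int m * real w))"
      using periodic_int_multiple[of E w "line (x - of_int m * real w)" m, OF perE] assms(2)
      by (simp add: Im_line) (simp add: line_def)
    ultimately show ?thesis using B by simp
  qed
  define X where "X n = E (line (s * real n + \<beta>))" for n :: nat
  have "(\<lambda>n. X n / of_nat n) \<longlonglongrightarrow> 0"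
  proof (rule Lim_null_comparison)
    show "\<forall>\<^sub>F n in sequentially. norm (X n / of_nat n) \<le> B / real n"
      using bd by (intro always_eventually allI) (auto simp: X_def norm_divide intro!: divide_right_mono)
    show "(\<lambda>n. B / real n) \<longlonglongrightarrow> 0" by (rule lim_const_over_n)
  qed
  moreover have "(\<lambda>n. c * (of_real s * \<i> + of_real \<beta>) / of_nat n) \<longlonglongrightarrow> 0" by (rule lim_const_over_n)
  moreover have "(\<lambda>n. of_real s * c) \<longlonglongrightarrow> of_real s * c" by simp
  ultimately have "(\<lambda>n. X n / of_nat n + c * (of_real s * \<i> + of_real \<beta>) / of_nat n + of_real s * c)
      \<longlonglongrightarrow> 0 + 0 + of_real s * c" by (intro tendsto_add)
  then have lim: "(\<lambda>n. X n / of_nat n + c * (of_real s * \<i> + of_real \<beta>) / of_nat n + of_real s * c)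
      \<longlonglongrightarrow> of_real s * c" by simp
  show ?thesis
  proof (rule Lim_transform_eventually[OF lim])
    show "\<forall>\<^sub>F n in sequentially. X n / of_nat n + c * (of_real s * \<i> + of_real \<beta>) / of_nat n + of_real s * c
        = P (of_real s * (\<i> + of_nat n) + of_real \<beta>) / of_nat n"
      using eventually_gt_at_top[of 0]
    proof eventually_elim
      case (elim n)
      have "P (of_real s * (\<i> + of_nat n) + of_real \<beta>) =
          X n + c * (of_real s * (\<i> + of_nat n) + of_real \<beta>)"
        by (simp add: X_def E_def line_def algebra_simps)
      then show ?case using elim by (simp add: field_simps)
    qed
  qed
qed

lemma coset_function_mult:
  assumes "det B = 1"
  shows "coset_function k (coset_function k F A) B = coset_function k F (A ** B)"
proof
  fix \<tau>
  show "coset_function k (coset_function k F A) B \<tau> = coset_function k F (A ** B) \<tau>"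
    using slash_mult[OF assms, of \<tau> k A F]
      slash_cong[of "coset_function k F A" "slash k A F" B \<tau> k, OF coset_function_eq assms]
    by (simp add: coset_function_def)
qed

text \<open>A weight two form on the full modular group has a primitive that is invariant under
  \<open>\<tau> \<mapsto> - 1 / \<tau>\<close> (look at the fixed point \<open>\<i>\<close>) and then under \<open>\<tau> \<mapsto> \<tau> + 1\<close>
  (look at the primitive sixth root of unity \<open>\<rho>\<close>, which satisfies \<open>- 1 / \<rho> + 1 = \<rho>\<close>).\<close>

lemma weight_two_primitive_periodic:
  assumes P: "\<And>\<tau>. Im \<tau> > 0 \<Longrightarrow> (P has_field_derivative T \<tau>) (at \<tau>)"
    and inv: "\<And>A \<tau>. A \<in> SL2Z \<Longrightarrow> Im \<tau> > 0 \<Longrightarrow> slash 2 A T \<tau> = T \<tau>"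
    and \<tau>: "Im \<tau> > 0"
  shows "P (\<tau> + 1) = P \<tau>"
proof -
  have step: "\<exists>d. \<forall>\<tau>. Im \<tau> > 0 \<longrightarrow> P (moebius_mat A \<tau>) - P \<tau> = d" if A: "A \<in> SL2Z" for A
  proof -
    have "((\<lambda>\<tau>. P (moebius_mat A \<tau>) - P \<tau>) has_field_derivative 0) (at \<tau>)" if "Im \<tau> > 0" for \<tau>
      using DERIV_diff[OF DERIV_chain2[OF P[OF Im_moebius_mat_pos[OF SL2Z_det[OF A] that]]
          has_field_derivative_moebius_mat[OF SL2Z_det[OF A] that]] P[OF that]] inv[OF A that]
      by (simp add: slash_def)
    from constant_on_upper_half_plane[OF this] show ?thesis by metis
  qed
  define A :: "real^2^2" where "A = vector [vector [0, -1], vector [1, 0]]"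
  define B :: "real^2^2" where "B = vector [vector [1, 1], vector [0, 1]]"
  have "A \<in> SL2Z" "B \<in> SL2Z" by (auto simp: SL2Z_def A_def B_def det_2 forall_2)
  then obtain d e where d: "\<And>\<tau>. Im \<tau> > 0 \<Longrightarrow> P (moebius_mat A \<tau>) - P \<tau> = d"
    and e: "\<And>\<tau>. Im \<tau> > 0 \<Longrightarrow> P (moebius_mat B \<tau>) - P \<tau> = e"
    using step by meson
  have A: "moebius_mat A \<tau> = - 1 / \<tau>" and B: "moebius_mat B \<tau> = \<tau> + 1" for \<tau>
    by (simp_all add: moebius_mat_def A_def B_def)
  have "d = 0" using d[of \<i>] by (simp add: A)
  define \<rho> where "\<rho> = Complex (1/2) (sqrt 3 / 2)"
  have "\<rho> * (\<rho> - 1) = - 1" by (simp add: \<rho>_def complex_eq_iff field_simps)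
  then have "- 1 / \<rho> = \<rho> - 1" by (metis mult_zero_left neg_equal_0_iff_equal nonzero_mult_div_cancel_left zero_neq_one)
  moreover have "Im \<rho> > 0" by (simp add: \<rho>_def)
  ultimately have "P (\<rho> - 1) = P \<rho>" using d[of \<rho>] \<open>d = 0\<close> by (simp add: A)
  then have "e = 0" using e[of "\<rho> - 1"] \<open>Im \<rho> > 0\<close> by (simp add: B)
  then show ?thesis using e[OF \<tau>] by (simp add: B)
qed

text \<open>The residue theorem on the modular curve, for forms without residue at the other cusps:
  the sum of all the slashed functions is a form on the full modular group, and the mean values
  of these functions along a horizontal line are nonnegative multiples of the residue at infinity.\<close>

theorem residue_at_infinity_zero:
  assumes N: "N > 0" and \<Gamma>: "Gamma0 N \<subseteq> \<Gamma>" "\<And>\<gamma>. \<gamma> \<in> \<Gamma> \<Longrightarrow> det \<gamma> = 1"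
    and inv: "\<And>\<gamma> \<tau>. \<gamma> \<in> \<Gamma> \<Longrightarrow> Im \<tau> > 0 \<Longrightarrow> slash 2 \<gamma> F \<tau> = F \<tau>"
    and L: "q_series 1 F L"
    and cusps: "\<And>\<gamma>. \<gamma> \<in> SL2Z \<Longrightarrow> other_cusp \<Gamma> \<gamma> \<Longrightarrow> \<exists>K<0. cusp_growth K (slash 2 \<gamma> F)"
  shows "fls_nth L 0 = 0"
proof -
  define \<F> where "\<F> = coset_function 2 F ` SL2Z"
  have fin: "finite \<F>" unfolding \<F>_def
    by (rule finite_coset_functions[OF N]) (rule inv[OF subsetD[OF \<Gamma>(1)]])
  define F1 where "F1 = coset_function 2 F (mat 1)"
  have F1: "F1 \<in> \<F>" using SL2Z_one by (simp add: F1_def \<F>_def)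
  have deriv_cont: "continuous_on upper_half_plane P"
    if "\<And>\<tau>. Im \<tau> > 0 \<Longrightarrow> (P has_field_derivative D \<tau>) (at \<tau>)" for P D :: "complex \<Rightarrow> complex"
    using that DERIV_isCont by (intro continuous_at_imp_continuous_on) blast
  obtain PF where PF: "\<And>\<tau>. Im \<tau> > 0 \<Longrightarrow> (PF has_field_derivative F \<tau>) (at \<tau>)"
    "\<And>\<tau>. Im \<tau> > 0 \<Longrightarrow> PF (\<tau> + of_nat 1) = PF \<tau> + of_nat 1 * fls_nth L 0"
    by (rule q_series_primitive[OF L zero_less_one]) (rule that)
  \<comment> \<open>\<kappa> will be 1 for \<open>F\<close> itself, \<open>\<alpha>\<^sup>2\<close>
    at a cusp equivalent to infinity and 0 at the others, where the decay leaves no constant term.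
    Strict positivity at \<open>F1\<close> keeps the total from being zero.\<close>
  have "\<exists>P \<kappa>. (\<forall>\<tau>. Im \<tau> > 0 \<longrightarrow> (P has_field_derivative G \<tau>) (at \<tau>)) \<and> \<kappa> \<ge> 0 \<and> (G = F1 \<longrightarrow> \<kappa> > 0)
      \<and> (\<lambda>n. P (\<i> + of_nat n) / of_nat n) \<longlonglongrightarrow> of_real \<kappa> * fls_nth L 0" if G: "G \<in> \<F>" for G
  proof (cases "G = F1")
    case True
    have "(\<lambda>n. PF (of_real 1 * (\<i> + of_nat n) + of_real 0) / of_nat n) \<longlonglongrightarrow> of_real 1 * fls_nth L 0"
      by (rule periodic_primitive_mean[OF zero_less_one zero_less_one deriv_cont[OF PF(1)] PF(2)])
    then show ?thesis
      using PF(1) by (intro exI[of _ PF] exI[of _ 1]) (simp add: True F1_def coset_function_def)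
  next
    case False
    obtain \<gamma> where \<gamma>: "\<gamma> \<in> SL2Z" "G = coset_function 2 F \<gamma>" using G unfolding \<F>_def by (elim imageE)
    show ?thesis
    proof (cases "other_cusp \<Gamma> \<gamma>")
      case True
      then obtain K where K: "K < 0" "cusp_growth K (slash 2 \<gamma> F)" using cusps[OF \<gamma>(1)] by blast
      then obtain w M where M: "w > 0" "q_series w (slash 2 \<gamma> F) M" "fls_nth M 0 = 0"
        by (metis cusp_growth_imp_q_series less_imp_le)
      obtain P where P: "\<And>\<tau>. Im \<tau> > 0 \<Longrightarrow> (P has_field_derivative slash 2 \<gamma> F \<tau>) (at \<tau>)"
        "\<And>\<tau>. Im \<tau> > 0 \<Longrightarrow> P (\<tau> + of_nat w) = P \<tau> + of_nat w * fls_nth M 0"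
        by (rule q_series_primitive[OF M(2,1)]) (rule that)
      have "(\<lambda>n. P (of_real 1 * (\<i> + of_nat n) + of_real 0) / of_nat n) \<longlonglongrightarrow> of_real 1 * fls_nth M 0"
        by (rule periodic_primitive_mean[OF M(1) zero_less_one deriv_cont[OF P(1)] P(2)])
      then show ?thesis
        using P(1) False by (intro exI[of _ P] exI[of _ 0]) (simp add: \<gamma>(2) coset_function_def M(3))
    next
      case equivalent: False
      obtain \<alpha> \<beta> :: real where "\<alpha> \<noteq> 0"
        and eq: "\<And>\<tau>. Im \<tau> > 0 \<Longrightarrow> slash 2 \<gamma> F \<tau> = of_real (\<alpha> ^ 2) * F (of_real (\<alpha>\<^sup>2) * \<tau> + of_real \<beta>)"
        by (rule cusp_equivalent_to_infinity[OF \<Gamma>(2) \<gamma>(1) equivalent inv]) (assumption | rule that)+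
      have pos: "\<alpha>\<^sup>2 > 0" using \<open>\<alpha> \<noteq> 0\<close> by simp
      define P where "P = (\<lambda>\<tau>. PF (of_real (\<alpha>\<^sup>2) * \<tau> + of_real \<beta>))"
      have "(P has_field_derivative G \<tau>) (at \<tau>)" if \<tau>: "Im \<tau> > 0" for \<tau>
      proof -
        have "Im (of_real (\<alpha>\<^sup>2) * \<tau> + of_real \<beta>) > 0" using \<tau> pos by simp
        moreover have "((\<lambda>\<tau>. of_real (\<alpha>\<^sup>2) * \<tau> + of_real \<beta>) has_field_derivative of_real (\<alpha>\<^sup>2)) (at \<tau>)"
          by (auto intro!: derivative_eq_intros)
        ultimately have "(P has_field_derivative F (of_real (\<alpha>\<^sup>2) * \<tau> + of_real \<beta>) * of_real (\<alpha>\<^sup>2)) (at \<tau>)"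
          unfolding P_def by (intro DERIV_chain2[OF PF(1)])
        then show ?thesis using eq[OF \<tau>] \<tau> by (simp add: \<gamma>(2) coset_function_def mult.commute)
      qed
      moreover have "(\<lambda>n. P (\<i> + of_nat n) / of_nat n) \<longlonglongrightarrow> of_real (\<alpha>\<^sup>2) * fls_nth L 0"
        unfolding P_def
        by (rule periodic_primitive_mean[OF zero_less_one pos deriv_cont[OF PF(1)] PF(2)])
      ultimately show ?thesis using False pos by (intro exI[of _ P] exI[of _ "\<alpha>\<^sup>2"]) simp
    qed
  qed
  then have "\<forall>G\<in>\<F>. \<exists>P. \<exists>\<kappa>. (\<forall>\<tau>. Im \<tau> > 0 \<longrightarrow> (P has_field_derivative G \<tau>) (at \<tau>)) \<and> \<kappa> \<ge> 0 \<and> (G = F1 \<longrightarrow> \<kappa> > 0)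
      \<and> (\<lambda>n. P (\<i> + of_nat n) / of_nat n) \<longlonglongrightarrow> of_real \<kappa> * fls_nth L 0" by (rule ballI)
  from bchoice[OF this] obtain P where "\<forall>G\<in>\<F>. \<exists>\<kappa>. (\<forall>\<tau>. Im \<tau> > 0 \<longrightarrow> (P G has_field_derivative G \<tau>) (at \<tau>)) \<and> \<kappa> \<ge> 0 \<and> (G = F1 \<longrightarrow> \<kappa> > 0)
      \<and> (\<lambda>n. P G (\<i> + of_nat n) / of_nat n) \<longlonglongrightarrow> of_real \<kappa> * fls_nth L 0" by (rule exE)
  from bchoice[OF this] obtain \<kappa> where "\<forall>G\<in>\<F>. (\<forall>\<tau>. Im \<tau> > 0 \<longrightarrow> (P G has_field_derivative G \<tau>) (at \<tau>)) \<and> \<kappa> G \<ge> 0 \<and> (G = F1 \<longrightarrow> \<kappa> G > 0)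
      \<and> (\<lambda>n. P G (\<i> + of_nat n) / of_nat n) \<longlonglongrightarrow> of_real (\<kappa> G) * fls_nth L 0" by (rule exE)
  then have P: "\<And>G \<tau>. G \<in> \<F> \<Longrightarrow> Im \<tau> > 0 \<Longrightarrow> (P G has_field_derivative G \<tau>) (at \<tau>)"
    and \<kappa>: "\<And>G. G \<in> \<F> \<Longrightarrow> \<kappa> G \<ge> 0" "\<kappa> F1 > 0"
    and lim: "\<And>G. G \<in> \<F> \<Longrightarrow> (\<lambda>n. P G (\<i> + of_nat n) / of_nat n) \<longlonglongrightarrow> of_real (\<kappa> G) * fls_nth L 0"
    using F1 by simp_all
  define T where "T \<tau> = (\<Sum>G\<in>\<F>. G \<tau>)" for \<tau>
  define Q where "Q \<tau> = (\<Sum>G\<in>\<F>. P G \<tau>)" for \<tau>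
  have Q: "(Q has_field_derivative T \<tau>) (at \<tau>)" if "Im \<tau> > 0" for \<tau>
    unfolding Q_def[abs_def] T_def using P that by (intro DERIV_sum) auto
  have T: "slash 2 A T \<tau> = T \<tau>" if A: "A \<in> SL2Z" and \<tau>: "Im \<tau> > 0" for A \<tau>
  proof -
    note det = SL2Z_det[OF A]
    \<comment> \<open>Right multiplication by \<open>A\<close> permutes \<open>SL2Z\<close>, so
      \<open>R\<close> maps the finite set onto itself and is therefore injective; slashing only
      permutes the summands of \<open>T\<close>.\<close>
    define R where "R G = coset_function 2 G A" for G
    have R: "R (coset_function 2 F B) = coset_function 2 F (B ** A)" for B
      unfolding R_def by (rule coset_function_mult[OF det])
    have "\<F> \<subseteq> R ` \<F>"
    proof
      fix G assume "G \<in> \<F>"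
      then obtain B where B: "B \<in> SL2Z" "G = coset_function 2 F B" unfolding \<F>_def by (elim imageE)
      have "(B ** inverse_2_2 A) ** A = B" using det by (simp add: matrix_mul_assoc[symmetric] inverse_2_2_left)
      then have "G = R (coset_function 2 F (B ** inverse_2_2 A))" by (simp add: R B)
      moreover have "coset_function 2 F (B ** inverse_2_2 A) \<in> \<F>"
        unfolding \<F>_def by (intro imageI SL2Z_mult SL2Z_inverse A B)
      ultimately show "G \<in> R ` \<F>" by (rule image_eqI)
    qed
    moreover have "R ` \<F> \<subseteq> \<F>" using A by (auto simp: \<F>_def R intro: SL2Z_mult)
    ultimately have img: "R ` \<F> = \<F>" by (intro equalityI)
    then have inj: "inj_on R \<F>" using fin by (intro finite_surj_inj) auto
    have "slash 2 A T \<tau> = (\<Sum>G\<in>\<F>. slash 2 A G \<tau>)" by (simp add: slash_def T_def sum_divide_distrib)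
    also have "\<dots> = (\<Sum>G\<in>\<F>. R G \<tau>)" by (simp add: R_def coset_function_def \<tau>)
    also have "\<dots> = (\<Sum>G\<in>R ` \<F>. G \<tau>)" by (simp add: sum.reindex[OF inj])
    finally show ?thesis by (simp add: img T_def)
  qed
  \<comment> \<open>Periodicity of \<open>Q\<close> makes its mean along the line tend to 0, while
    adding up the individual means gives a positive multiple of the residue.\<close>
  have "Q (\<i> + of_nat n) = Q \<i>" for n
  proof (induction n)
    case (Suc n)
    have "Q (\<i> + of_nat (Suc n)) = Q ((\<i> + of_nat n) + 1)" by (simp add: add_ac)
    also have "\<dots> = Q (\<i> + of_nat n)" by (rule weight_two_primitive_periodic[OF Q T]) auto
    finally show ?case using Suc by simp
  qed simp
  then have "(\<lambda>n. Q (\<i> + of_nat n) / of_nat n) \<longlonglongrightarrow> 0"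
    using lim_const_over_n[of "Q \<i>"] by simp
  moreover have "(\<lambda>n. \<Sum>G\<in>\<F>. P G (\<i> + of_nat n) / of_nat n) \<longlonglongrightarrow> (\<Sum>G\<in>\<F>. of_real (\<kappa> G) * fls_nth L 0)"
    by (intro tendsto_sum lim)
  then have "(\<lambda>n. Q (\<i> + of_nat n) / of_nat n) \<longlonglongrightarrow> of_real (\<Sum>G\<in>\<F>. \<kappa> G) * fls_nth L 0"
    by (simp add: Q_def sum_divide_distrib sum_distrib_right)
  ultimately have "of_real (\<Sum>G\<in>\<F>. \<kappa> G) * fls_nth L 0 = 0" using LIMSEQ_unique by blast
  moreover have "(\<Sum>G\<in>\<F>. \<kappa> G) > 0" using fin F1 \<kappa> by (intro sum_pos2[of _ F1]) auto
  ultimately show ?thesis by (simp del: of_real_sum)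
qed

section \<open>Pairing functions with forms of weight two\<close>

lemma fls_times_nth_lower_bounds:
  fixes F G :: "'a::{comm_monoid_add, mult_zero} fls"
  assumes "\<And>n. n < A \<Longrightarrow> fls_nth F n = 0" "\<And>n. n < B \<Longrightarrow> fls_nth G n = 0"
  shows "fls_nth (F * G) n = (\<Sum>i=A..n - B. fls_nth F i * fls_nth G (n - i))"
proof (cases "F = 0 \<or> G = 0")
  case False
  then have "A \<le> fls_subdegree F" "B \<le> fls_subdegree G"
    using assms by (auto intro!: fls_subdegree_geI)
  then show ?thesis
    unfolding fls_times_nth(2) by (intro sum.mono_neutral_left) auto
qed auto

text \<open>The conditions on a form of weight two that make its product with every function in
  \<open>M0_infty\<close> satisfy the assumptions of the residue theorem.\<close>

definition weight_two_dual :: "(real^2^2) set \<Rightarrow> (complex \<Rightarrow> complex) \<Rightarrow> bool" where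
  "weight_two_dual \<Gamma> G \<longleftrightarrow> (\<forall>\<gamma>\<in>\<Gamma>. \<forall>\<tau>. Im \<tau> > 0 \<longrightarrow> slash 2 \<gamma> G \<tau> = G \<tau>)
     \<and> (\<forall>\<gamma>\<in>SL2Z. other_cusp \<Gamma> \<gamma> \<longrightarrow> (\<exists>K<0. cusp_growth K (slash 2 \<gamma> G)))"

lemma q_series_imp_decay:
  assumes "q_series w F L" "w > 0" "\<And>n. n < 1 \<Longrightarrow> fls_nth L n = 0"
  shows "\<exists>K<0. cusp_growth K F"
  using q_series_imp_cusp_growth[OF assms, of 1] assms(2)
  by (intro exI[of _ "- 2 * pi * real_of_int 1 / real w"]) (auto simp: divide_neg_pos)

lemma weight_two_dual_S2_infty:
  assumes "H \<in> S2_infty \<Gamma>"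
  shows "weight_two_dual \<Gamma> H"
  unfolding weight_two_dual_def
proof (intro conjI ballI allI impI)
  fix \<gamma> assume "\<gamma> \<in> SL2Z" "other_cusp \<Gamma> \<gamma>"
  then have "order_at_cusp_ge 2 \<gamma> H 1" using assms by (simp add: S2_infty_def)
  then obtain w L where "w > 0" "q_series w (slash 2 \<gamma> H) L" "\<And>n. n < 1 \<Longrightarrow> fls_nth L n = 0"
    by (rule order_at_cusp_ge_imp_q_series) (rule that)
  then show "\<exists>K<0. cusp_growth K (slash 2 \<gamma> H)" by (intro q_series_imp_decay)
qed (use assms in \<open>simp add: S2_infty_def weakly_holomorphic_forms_def\<close>)

lemma slash_deriv:
  assumes "F holomorphic_on upper_half_plane" "det A = 1" "Im \<tau> > 0"
  shows "slash 2 A (deriv F) \<tau> = deriv (slash 0 A F) \<tau>"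
proof -
  have "(F has_field_derivative deriv F (moebius_mat A \<tau>)) (at (moebius_mat A \<tau>))"
    using Im_moebius_mat_pos[OF assms(2,3)]
    by (intro holomorphic_derivI[OF assms(1) open_upper_half_plane]) simp
  from DERIV_chain2[OF this has_field_derivative_moebius_mat[OF assms(2,3)]]
  have "deriv (\<lambda>\<tau>. F (moebius_mat A \<tau>)) \<tau> = deriv F (moebius_mat A \<tau>) / (denom A \<tau>)\<^sup>2"
    by (intro DERIV_imp_deriv) simp
  then show ?thesis by (simp add: slash_def[abs_def])
qed

lemma deriv_cong_upper_half_plane:
  assumes "\<And>\<tau>. Im \<tau> > 0 \<Longrightarrow> F \<tau> = G \<tau>" "Im \<tau> > 0"
  shows "deriv F \<tau> = deriv G \<tau>"
proof (rule deriv_cong_ev)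
  show "eventually (\<lambda>\<tau>. F \<tau> = G \<tau>) (nhds \<tau>)"
    using eventually_nhds_in_open[OF open_upper_half_plane, of \<tau>] assms
    by (auto elim: eventually_mono)
qed simp

text \<open>At every other cusp the function has no negative exponents, and differentiation removes
  the constant term, so the derivative vanishes there even if the function does not.\<close>

lemma weight_two_dual_deriv:
  assumes F: "F \<in> M0_infty \<Gamma>" and \<Gamma>: "\<And>\<gamma>. \<gamma> \<in> \<Gamma> \<Longrightarrow> det \<gamma> = 1"
  shows "weight_two_dual \<Gamma> (deriv F)"
proof -
  have hol: "F holomorphic_on upper_half_plane" using F by (simp add: M0_infty_iff)
  show ?thesis
    unfolding weight_two_dual_def
  proof (intro conjI ballI allI impI)
    fix \<gamma> and \<tau> :: complex assume "\<gamma> \<in> \<Gamma>" "Im \<tau> > 0"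
    then have "slash 2 \<gamma> (deriv F) \<tau> = deriv (slash 0 \<gamma> F) \<tau>" by (intro slash_deriv hol \<Gamma>)
    also have "\<dots> = deriv F \<tau>"
      using F \<open>\<gamma> \<in> \<Gamma>\<close> \<open>Im \<tau> > 0\<close> by (intro deriv_cong_upper_half_plane) (auto simp: M0_infty_iff)
    finally show "slash 2 \<gamma> (deriv F) \<tau> = deriv F \<tau>" .
  next
    fix \<gamma> assume \<gamma>: "\<gamma> \<in> SL2Z" "other_cusp \<Gamma> \<gamma>"
    then have "cusp_growth 0 (slash 0 \<gamma> F)" using F by (simp add: M0_infty_iff)
    then obtain w L where L: "w > 0" "q_series w (slash 0 \<gamma> F) L" "\<And>n. n < 0 \<Longrightarrow> fls_nth L n = 0"
      by (rule cusp_growth_imp_q_series[OF _ order.refl]) (rule that)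
    have "q_series w (slash 2 \<gamma> (deriv F)) (fls_const (2 * of_real pi * \<i> / of_nat w) * (fls_X * fls_deriv L))"
      by (rule q_series_cong[OF q_series_deriv[OF L(2,1)]]) (rule slash_deriv[OF hol SL2Z_det[OF \<gamma>(1)]])
    then show "\<exists>K<0. cusp_growth K (slash 2 \<gamma> (deriv F))"
    proof (rule q_series_imp_decay[OF _ L(1)])
      fix n :: int assume "n < 1"
      then consider "n < 0" | "n = 0" by linarith
      then show "fls_nth (fls_const (2 * of_real pi * \<i> / of_nat w) * (fls_X * fls_deriv L)) n = 0"
        by cases (simp_all add: fls_X_times_conv_shift L(3))
    qed
  qed
qed

text \<open>At the other cusps a factor without pole meets a decaying one, so the product decays and
  has no residue there. The constant coefficient at infinity is, up to a constant factor, the only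
  residue left.\<close>

lemma residue_duality:
  assumes "N > 0" "Gamma0 N \<subseteq> \<Gamma>" "\<And>\<gamma>. \<gamma> \<in> \<Gamma> \<Longrightarrow> det \<gamma> = 1"
    and F: "F \<in> M0_infty \<Gamma>" and G: "weight_two_dual \<Gamma> G"
    and L: "q_series 1 F L" and K: "q_series 1 G K"
  shows "fls_nth (L * K) 0 = 0"
proof (rule residue_at_infinity_zero[OF assms(1-3)])
  have eq: "slash 2 \<gamma> (\<lambda>\<tau>. F \<tau> * G \<tau>) = (\<lambda>\<tau>. slash 0 \<gamma> F \<tau> * slash 2 \<gamma> G \<tau>)" for \<gamma>
    by (simp add: slash_def fun_eq_iff)
  show "slash 2 \<gamma> (\<lambda>\<tau>. F \<tau> * G \<tau>) \<tau> = F \<tau> * G \<tau>" if "\<gamma> \<in> \<Gamma>" "Im \<tau> > 0" for \<gamma> \<tau>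
    using F G that by (simp add: eq M0_infty_iff weight_two_dual_def)
  show "\<exists>K<0. cusp_growth K (slash 2 \<gamma> (\<lambda>\<tau>. F \<tau> * G \<tau>))" if \<gamma>: "\<gamma> \<in> SL2Z" "other_cusp \<Gamma> \<gamma>" for \<gamma>
  proof -
    obtain K where K: "K < 0" "cusp_growth K (slash 2 \<gamma> G)"
      using G \<gamma> unfolding weight_two_dual_def by blast
    moreover have "cusp_growth 0 (slash 0 \<gamma> F)" using F \<gamma> by (simp add: M0_infty_iff)
    ultimately show ?thesis
      using cusp_growth_mult[of 0 "slash 0 \<gamma> F" K "slash 2 \<gamma> G"] by (auto simp: eq)
  qed
  show "q_series 1 (\<lambda>\<tau>. F \<tau> * G \<tau>) (L * K)" by (intro q_series_mult L K) simp
qed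

section \<open>Dual families and the generating function\<close>

locale modular_families =
  fixes N g :: nat and S :: "nat set"
    and f :: "nat \<Rightarrow> complex \<Rightarrow> complex" and a :: "nat \<Rightarrow> int \<Rightarrow> complex"
    and h :: "int \<Rightarrow> complex \<Rightarrow> complex" and b :: "int \<Rightarrow> int \<Rightarrow> complex"
  assumes N: "N > 0" and S: "S \<subseteq> exact_divisors N"
    and not_weierstrass: "\<not> infinity_weierstrass_point (Gamma_plus N S) g"
    and f_family: "is_f_family (Gamma_plus N S) g f a"
    and h_family: "is_h_family (Gamma_plus N S) g h b"
begin

abbreviation \<Gamma> :: "(real^2^2) set" where "\<Gamma> \<equiv> Gamma_plus N S"

lemma det_\<Gamma>: "\<gamma> \<in> \<Gamma> \<Longrightarrow> det \<gamma> = 1"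
  by (rule det_Gamma_plus[OF N S])

lemma f_0: "Im \<tau> > 0 \<Longrightarrow> f 0 \<tau> = 1"
  and f_gap: "1 \<le> m \<Longrightarrow> m \<le> g \<Longrightarrow> Im \<tau> > 0 \<Longrightarrow> f m \<tau> = 0"
  using f_family by (simp_all add: is_f_family_def)

lemma f_in_M0_infty: "m > g \<Longrightarrow> f m \<in> M0_infty \<Gamma>"
  and a_lead: "m > g \<Longrightarrow> a m (- int m) = 1"
  and a_0: "m > g \<Longrightarrow> a m 0 = 0"
  and a_gap: "m > g \<Longrightarrow> n < - int g \<Longrightarrow> n \<noteq> - int m \<Longrightarrow> a m n = 0"
  and f_has_q_expansion: "m > g \<Longrightarrow> has_q_expansion 1 (f m) (a m)"
  using f_family by (simp_all add: is_f_family_def)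

lemma a_below: "m > g \<Longrightarrow> n < - int m \<Longrightarrow> a m n = 0"
  by (rule a_gap) auto

lemma h_in_S2_infty: "n \<ge> - int g \<Longrightarrow> n \<noteq> 0 \<Longrightarrow> h n \<in> S2_infty \<Gamma>"
  and b_lead: "n \<ge> - int g \<Longrightarrow> n \<noteq> 0 \<Longrightarrow> b n (- n) = 1"
  and b_gap: "n \<ge> - int g \<Longrightarrow> n \<noteq> 0 \<Longrightarrow> m \<le> int g \<Longrightarrow> m \<noteq> - n \<Longrightarrow> b n m = 0"
  and h_has_q_expansion: "n \<ge> - int g \<Longrightarrow> n \<noteq> 0 \<Longrightarrow> has_q_expansion 1 (h n) (b n)"
  using h_family by (simp_all add: is_h_family_def)

lemma b_below: "n \<ge> - int g \<Longrightarrow> n \<noteq> 0 \<Longrightarrow> m < - n \<Longrightarrow> b n m = 0"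
  by (rule b_gap) auto

lemma fls_nth_a [simp]: "m > g \<Longrightarrow> fls_nth (Abs_fls (a m)) = a m"
  by (intro ext nth_Abs_fls_lower_bound[of "- int m"]) (simp add: a_below)

lemma fls_nth_b [simp]: "n \<ge> - int g \<Longrightarrow> n \<noteq> 0 \<Longrightarrow> fls_nth (Abs_fls (b n)) = b n"
  by (intro ext nth_Abs_fls_lower_bound[of "- n"]) (simp add: b_below)

lemma q_series_f: "m > g \<Longrightarrow> q_series 1 (f m) (Abs_fls (a m))"
  by (rule has_q_expansion_imp_q_series[OF f_has_q_expansion zero_less_one a_below])

lemma q_series_h: "n \<ge> - int g \<Longrightarrow> n \<noteq> 0 \<Longrightarrow> q_series 1 (h n) (Abs_fls (b n))"
  by (rule has_q_expansion_imp_q_series[OF h_has_q_expansion zero_less_one b_below])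

text \<open>The gaps are complementary: apart from their leading terms, \<open>f m\<close> has
  exponents at least \<open>- g\<close> and \<open>h n\<close> exponents above \<open>g\<close>. So
  only two terms reach the constant coefficient of the product, each pairing the leading term of one
  factor with a coefficient of the other.\<close>

lemma duality:
  assumes m: "m > g" and n: "n \<ge> - int g" "n \<noteq> 0"
  shows "b n (int m) = - a m n"
proof -
  have "0 = fls_nth (Abs_fls (a m) * Abs_fls (b n)) 0"
    by (rule residue_duality[OF N Gamma0_subset_Gamma_plus det_\<Gamma> f_in_M0_infty[OF m]
          weight_two_dual_S2_infty[OF h_in_S2_infty[OF n]] q_series_f[OF m] q_series_h[OF n], symmetric])
  also have "\<dots> = (\<Sum>i=- int m..0 - (- n). a m i * b n (0 - i))"
    using m n by (subst fls_times_nth_lower_bounds[of "- int m" _ "- n"]) (auto simp: a_below b_below)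
  also have "\<dots> = (\<Sum>i\<in>{- int m, n}. a m i * b n (- i))"
  proof (rule sum.mono_neutral_cong_right)
    show "\<forall>i\<in>{- int m..0 - (- n)} - {- int m, n}. a m i * b n (0 - i) = 0"
    proof
      fix i assume "i \<in> {- int m..0 - (- n)} - {- int m, n}"
      then show "a m i * b n (0 - i) = 0"
        using a_gap[OF m, of i] b_gap[OF n, of "- i"] by (cases "i < - int g") auto
    qed
  qed (use m n in auto)
  also have "\<dots> = b n (int m) + a m n" using m n by (simp add: a_lead b_lead)
  finally show ?thesis by (simp add: eq_neg_iff_add_eq_0)
qed

text \<open>The constant coefficient of \<open>f n\<close> times the derivative of
  \<open>f m\<close>: the coefficient at \<open>- i\<close> acquires the factor \<open>- i\<close>,
  and the common constant cancels.\<close>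

lemma derivative_duality:
  assumes m: "m > g" and n: "n > g"
  shows "(\<Sum>i=- int n..int m. of_int i * a n i * a m (- i)) = 0"
proof -
  define c where "c = 2 * of_real pi * \<i> / of_nat 1"
  define D where "D = fls_const c * (fls_X * fls_deriv (Abs_fls (a m)))"
  have D: "fls_nth D k = c * of_int k * a m k" for k
    using m by (simp add: D_def fls_X_times_conv_shift)
  have "0 = fls_nth (Abs_fls (a n) * D) 0"
    unfolding D_def c_def
    by (rule residue_duality[OF N Gamma0_subset_Gamma_plus det_\<Gamma> f_in_M0_infty[OF n]
          weight_two_dual_deriv[OF f_in_M0_infty[OF m] det_\<Gamma>] q_series_f[OF n]
          q_series_deriv[OF q_series_f[OF m] zero_less_one], symmetric])
  also have "\<dots> = (\<Sum>i=- int n..0 - (- int m). a n i * (c * of_int (0 - i) * a m (0 - i)))"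
    using m n by (subst fls_times_nth_lower_bounds[of "- int n" _ "- int m"]) (auto simp: a_below D)
  also have "\<dots> = - c * (\<Sum>i=- int n..int m. of_int i * a n i * a m (- i))"
    by (simp add: sum_distrib_left sum_negf mult_ac)
  finally show ?thesis by (simp add: c_def)
qed

text \<open>Subtracting multiples of the \<open>f j\<close> removes all exponents below
  \<open>- g\<close> and leaves a pole of order at most \<open>g\<close>, which must be absent. The
  coefficients of \<open>L\<close> between \<open>- g\<close> and -1 are thus determined by the
  others and do not occur in the formula.\<close>

lemma M0_infty_expansion:
  assumes F: "F \<in> M0_infty \<Gamma>" and L: "q_series 1 F L" "\<And>n. n < - int m \<Longrightarrow> fls_nth L n = 0"
    and \<tau>: "Im \<tau> > 0"
  shows "F \<tau> = fls_nth L 0 + (\<Sum>j=g + 1..m. fls_nth L (- int j) * f j \<tau>)"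
proof -
  define G where "G = (\<lambda>\<tau>. (F \<tau> + - fls_nth L 0) + (\<Sum>j=g + 1..m. - fls_nth L (- int j) * f j \<tau>))"
  define K where "K = (L + fls_const (- fls_nth L 0)) +
      (\<Sum>j=g + 1..m. fls_const (- fls_nth L (- int j)) * Abs_fls (a j))"
  have G: "G \<in> M0_infty \<Gamma>"
    unfolding G_def
    by (intro M0_infty_add F M0_infty_const M0_infty_sum M0_infty_mult f_in_M0_infty) auto
  have K: "q_series 1 G K"
    unfolding G_def K_def
    by (intro q_series_add q_series_sum q_series_mult q_series_const L q_series_f) auto
  have nth: "fls_nth K n = fls_nth L n - (if n = 0 then fls_nth L 0 else 0) -
      (\<Sum>j=g + 1..m. fls_nth L (- int j) * a j n)" for n
    by (simp add: K_def fls_nth_sum sum_negf)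
  have low: "fls_nth K n = 0" if "n < - int g" for n
  proof -
    have "(\<Sum>j=g + 1..m. fls_nth L (- int j) * a j n) = (\<Sum>j=g + 1..m. if j = nat (- n) then fls_nth L n else 0)"
      using that a_lead[of "nat (- n)"] by (intro sum.cong) (auto simp: a_gap)
    also have "\<dots> = fls_nth L n" using that L(2)[of n] by auto
    finally show ?thesis using that by (simp add: nth)
  qed
  have zero: "fls_nth K 0 = 0" by (simp add: nth a_0)
  have neg: "fls_nth K n = 0" if "n < 0" for n
  proof (rule ccontr)
    assume ne: "fls_nth K n \<noteq> 0"
    \<comment> \<open>The negative of the lowest exponent of \<open>K\<close> is a pole order
      between 1 and \<open>g\<close>, contradicting that infinity is not a Weierstrass
      point.\<close>
    define d where "d = fls_subdegree K"
    have "K \<noteq> 0" using ne by auto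
    then have d: "fls_nth K d \<noteq> 0" "\<And>k. k < d \<Longrightarrow> fls_nth K k = 0" by (simp_all add: d_def)
    have "d \<le> n" unfolding d_def using ne by (rule fls_subdegree_leI)
    moreover have "d \<ge> - int g" using low d(1) by force
    ultimately have "nat (- d) \<in> {1..g}" "- int (nat (- d)) = d" using that by auto
    then have "infinity_weierstrass_point \<Gamma> g"
      unfolding infinity_weierstrass_point_def
      using G q_series_imp_has_q_expansion[OF K zero_less_one] d
      by (intro bexI[of _ G] exI[of _ "fls_nth K"] bexI[of _ "nat (- d)"] conjI) auto
    with not_weierstrass show False ..
  qed
  have "G \<tau> = 0"
    by (rule M0_infty_vanishing[OF N Gamma0_subset_Gamma_plus det_\<Gamma> G K _ \<tau>])
       (use neg zero in \<open>auto simp: order.order_iff_strict\<close>)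
  then show ?thesis by (simp add: G_def sum_negf algebra_simps)
qed

section \<open>Coefficients of the numerator and of the generating series\<close>

text \<open>The coefficient at exponent \<open>l\<close> when \<open>f (g + 1)\<close>, expanded in
  the second variable, multiplies the part of the generating series with indices above
  \<open>g\<close>. The last term, \<open>j = l + g + 1\<close>, is \<open>f (l + g + 1)\<close>
  because the leading coefficient is 1.\<close>

definition shifted_sum :: "complex \<Rightarrow> nat \<Rightarrow> complex" where
  "shifted_sum \<tau> l = (\<Sum>j=g + 1..l + g + 1. a (g + 1) (int l - int j) * f j \<tau>)"

text \<open>The expansion of \<open>A_fun\<close> in the second variable. Index 0 is left out
  because \<open>h 0\<close> is unconstrained; its factor \<open>a (g + 1) 0\<close> is 0.\<close>

definition numerator :: "complex \<Rightarrow> complex fls" where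
  "numerator \<tau> =
     (\<Sum>l\<in>{- int g..int g + 1} - {0}. fls_const (of_int (1 - l) * a (g + 1) (- l)) * Abs_fls (b l))
   + (\<Sum>l=1..g. fls_const (shifted_sum \<tau> l) * Abs_fls (b (- int l)))"

definition generating_series :: "complex \<Rightarrow> complex fls" where
  "generating_series \<tau> = fps_to_fls (Abs_fps (\<lambda>n. f n \<tau>))"

text \<open>Interchanging the double sum turns its range into \<open>1 \<le> l \<le> g\<close>,
  \<open>g + 1 \<le> j \<le> l + g\<close>; the single sum over \<open>f (l + g + 1)\<close>
  supplies the missing index \<open>j = l + g + 1\<close>.\<close>

lemma A_fun_eq:
  "A_fun g f a h \<tau>1 \<tau>2 =
     (\<Sum>l\<in>{- int g..int g + 1} - {0}. (of_int (1 - l) * a (g + 1) (- l)) * h l \<tau>2)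
   + (\<Sum>l=1..g. shifted_sum \<tau>1 l * h (- int l) \<tau>2)"
proof -
  define t where "t j l = a (g + 1) (int l - int j) * f j \<tau>1 * h (- int l) \<tau>2" for j l
  have "(\<Sum>j=g + 1..2 * g. \<Sum>l=j - g..g. t j l) = (\<Sum>j=g + 1..2 * g. \<Sum>l\<in>{l\<in>{1..g}. j \<le> l + g}. t j l)"
    by (intro sum.cong refl) auto
  also have "\<dots> = (\<Sum>l=1..g. \<Sum>j\<in>{j\<in>{g + 1..2 * g}. j \<le> l + g}. t j l)"
    by (rule sum.swap_restrict) auto
  also have "\<dots> = (\<Sum>l=1..g. \<Sum>j=g + 1..l + g. t j l)"
    by (intro sum.cong refl) auto
  finally have swap: "(\<Sum>j=g + 1..2 * g. \<Sum>l=j - g..g. t j l) = (\<Sum>l=1..g. \<Sum>j=g + 1..l + g. t j l)" .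
  have "f (l + g + 1) \<tau>1 * h (- int l) \<tau>2 + (\<Sum>j=g + 1..l + g. t j l) = shifted_sum \<tau>1 l * h (- int l) \<tau>2" for l
  proof -
    have "shifted_sum \<tau>1 l = (\<Sum>j=g + 1..l + g. a (g + 1) (int l - int j) * f j \<tau>1) + f (l + g + 1) \<tau>1"
      using a_lead[of "g + 1"] by (simp add: shifted_sum_def)
    then show ?thesis by (simp add: t_def sum_distrib_right distrib_right)
  qed
  then have "(\<Sum>l=1..g. f (l + g + 1) \<tau>1 * h (- int l) \<tau>2) + (\<Sum>j=g + 1..2 * g. \<Sum>l=j - g..g. t j l)
      = (\<Sum>l=1..g. shifted_sum \<tau>1 l * h (- int l) \<tau>2)"
    unfolding swap by (simp flip: sum.distrib)
  moreover have "(\<Sum>l=- int g..int g + 1. of_int (1 - l) * a (g + 1) (- l) * h l \<tau>2) =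
      (\<Sum>l\<in>{- int g..int g + 1} - {0}. (of_int (1 - l) * a (g + 1) (- l)) * h l \<tau>2)"
    by (rule sum.mono_neutral_right) (auto simp: a_0)
  ultimately show ?thesis unfolding A_fun_def t_def by (simp add: add.assoc)
qed

lemma q_series_A_fun: "q_series 1 (A_fun g f a h \<tau>1) (numerator \<tau>1)"
  unfolding A_fun_eq[abs_def] numerator_def
  by (intro q_series_add q_series_sum q_series_mult q_series_const q_series_h) auto

lemma fls_nth_generating_series:
  "fls_nth (generating_series \<tau>) n = (if n < 0 then 0 else f (nat n) \<tau>)"
  by (simp add: generating_series_def)

lemma numerator_nth:
  "fls_nth (numerator \<tau>) n =
     (\<Sum>l\<in>{- int g..int g + 1} - {0}. (of_int (1 - l) * a (g + 1) (- l)) * b l n)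
   + (\<Sum>l=1..g. shifted_sum \<tau> l * b (- int l) n)"
  by (simp add: numerator_def fls_nth_sum)

text \<open>Up to exponent \<open>g\<close> each \<open>h l\<close> shows only its leading term, so
  exponent \<open>n\<close> selects \<open>l = - n\<close> in the first sum and \<open>l = n\<close>
  in the second.\<close>

lemma numerator_nth_low:
  assumes n: "n \<le> int g"
  shows "fls_nth (numerator \<tau>) n =
    of_int (1 + n) * a (g + 1) n + (if 1 \<le> n then shifted_sum \<tau> (nat n) else 0)"
proof -
  have "(\<Sum>l\<in>{- int g..int g + 1} - {0}. (of_int (1 - l) * a (g + 1) (- l)) * b l n) =
      (\<Sum>l\<in>{- int g..int g + 1} - {0}. if l = - n then of_int (1 + n) * a (g + 1) n else 0)"
    using n b_lead[of "- n"] by (intro sum.cong refl) (auto simp: b_gap)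
  also have "\<dots> = of_int (1 + n) * a (g + 1) n"
    \<comment> \<open>The index \<open>- n\<close> is outside the range for \<open>n = 0\<close> and
      for \<open>n < - g - 1\<close>, but \<open>a (g + 1) n\<close> is 0 in both cases.\<close>
    using n a_0[of "g + 1"] a_below[of "g + 1" n] by (auto simp: sum.delta)
  finally have 1: "(\<Sum>l\<in>{- int g..int g + 1} - {0}. (of_int (1 - l) * a (g + 1) (- l)) * b l n) =
      of_int (1 + n) * a (g + 1) n" .
  have lead: "b (- n) n = 1" if "1 \<le> nat n" using b_lead[of "- n"] n that by auto
  have "(\<Sum>l=1..g. shifted_sum \<tau> l * b (- int l) n) = (\<Sum>l=1..g. if l = nat n then shifted_sum \<tau> (nat n) else 0)"
    using n lead by (intro sum.cong refl) (auto simp: b_gap)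
  also have "\<dots> = (if 1 \<le> n then shifted_sum \<tau> (nat n) else 0)" using n by auto
  finally show ?thesis unfolding numerator_nth 1 by simp
qed

text \<open>The leading term of \<open>f n\<close> shifts the coefficients of
  \<open>f (g + 1)\<close> and yields \<open>shifted_sum \<tau> n + a (g + 1) n\<close>. Its terms
  of exponent \<open>- l\<close> with \<open>1 \<le> l \<le> g\<close> yield multiples of
  \<open>shifted_sum \<tau> l\<close> in the same way, and the first sum over \<open>l\<close> is
  the rest of the constant coefficient of the product.\<close>

lemma product_expansion:
  assumes n: "n > g" and \<tau>: "Im \<tau> > 0"
  shows "f (g + 1) \<tau> * f n \<tau> = shifted_sum \<tau> n + a (g + 1) n
    + (\<Sum>l=- int g..int g + 1. a n l * a (g + 1) (- l))
    + (\<Sum>l=1..g. shifted_sum \<tau> l * a n (- int l))"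
proof -
  define P where "P = Abs_fls (a n) * Abs_fls (a (g + 1))"
  have P: "fls_nth P k = (\<Sum>i=- int n..k + int (g + 1). a n i * a (g + 1) (k - i))" for k
  proof -
    have "fls_nth P k = (\<Sum>i=- int n..k - (- int (g + 1)).
        fls_nth (Abs_fls (a n)) i * fls_nth (Abs_fls (a (g + 1))) (k - i))"
      unfolding P_def by (rule fls_times_nth_lower_bounds) (use n in \<open>simp_all add: a_below\<close>)
    then show ?thesis using n unfolding diff_minus_eq_add by simp
  qed
  have P': "fls_nth P k = a (g + 1) (k + int n) + (\<Sum>i=- int g..k + int (g + 1). a n i * a (g + 1) (k - i))"
    if "k \<ge> - int n - int (g + 1)" for k
  proof -
    have "fls_nth P k = (\<Sum>i\<in>insert (- int n) {- int g..k + int (g + 1)}. a n i * a (g + 1) (k - i))"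
      unfolding P using n that by (intro sum.mono_neutral_right) (auto simp: a_gap)
    also have "\<dots> = a n (- int n) * a (g + 1) (k - - int n) + (\<Sum>i=- int g..k + int (g + 1). a n i * a (g + 1) (k - i))"
      using n by (intro sum.insert) auto
    finally show ?thesis using n by (simp add: a_lead)
  qed
  have "f n \<tau> * f (g + 1) \<tau> = fls_nth P 0 + (\<Sum>j=g + 1..n + g + 1. fls_nth P (- int j) * f j \<tau>)"
  proof (rule M0_infty_expansion[OF _ _ _ \<tau>])
    show "(\<lambda>\<tau>. f n \<tau> * f (g + 1) \<tau>) \<in> M0_infty \<Gamma>" using n by (intro M0_infty_mult f_in_M0_infty) auto
    show "q_series 1 (\<lambda>\<tau>. f n \<tau> * f (g + 1) \<tau>) P" unfolding P_def using n by (intro q_series_mult q_series_f) auto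
    show "fls_nth P k = 0" if "k < - int (n + g + 1)" for k using that by (simp add: P)
  qed
  also have "fls_nth P 0 = a (g + 1) n + (\<Sum>l=- int g..int g + 1. a n l * a (g + 1) (- l))"
    by (subst P') (auto simp: add.commute)
  also have "(\<Sum>j=g + 1..n + g + 1. fls_nth P (- int j) * f j \<tau>) =
      (\<Sum>j=g + 1..n + g + 1. (a (g + 1) (int n - int j) + (\<Sum>l=1..g. a n (- int l) * a (g + 1) (int l - int j))) * f j \<tau>)"
  proof (intro sum.cong refl)
    fix j assume j: "j \<in> {g + 1..n + g + 1}"
    have "(\<Sum>l=1..g. a n (- int l) * a (g + 1) (int l - int j)) = (\<Sum>i=- int g..- 1. a n i * a (g + 1) (- int j - i))"
      by (rule sum.reindex_bij_witness[of _ "\<lambda>i. nat (- i)" "\<lambda>l. - int l"]) auto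
    also have "\<dots> = (\<Sum>i=- int g..- int j + int (g + 1). a n i * a (g + 1) (- int j - i))"
    proof (rule sum.mono_neutral_cong)
      fix i assume "i \<in> {- int g..- int j + int (g + 1)} - {- int g..- 1}"
      \<comment> \<open>Only \<open>j = g + 1\<close> lets the range reach 0, where the
        normalisation \<open>a n 0 = 0\<close> removes the extra term.\<close>
      then have "i = 0" using j by auto
      then show "a n i * a (g + 1) (- int j - i) = 0" using n by (simp add: a_0)
    next
      fix i assume "i \<in> {- int g..- 1} - {- int g..- int j + int (g + 1)}"
      then show "a n i * a (g + 1) (- int j - i) = 0" by (auto simp: a_below)
    qed auto
    finally show "fls_nth P (- int j) * f j \<tau> =
        (a (g + 1) (int n - int j) + (\<Sum>l=1..g. a n (- int l) * a (g + 1) (int l - int j))) * f j \<tau>"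
      using j by (subst P') auto
  qed
  also have "\<dots> = shifted_sum \<tau> n
      + (\<Sum>j=g + 1..n + g + 1. \<Sum>l=1..g. a n (- int l) * a (g + 1) (int l - int j) * f j \<tau>)"
    by (simp add: shifted_sum_def distrib_right sum.distrib sum_distrib_right)
  also have "(\<Sum>j=g + 1..n + g + 1. \<Sum>l=1..g. a n (- int l) * a (g + 1) (int l - int j) * f j \<tau>) =
      (\<Sum>l=1..g. \<Sum>j=g + 1..n + g + 1. a n (- int l) * a (g + 1) (int l - int j) * f j \<tau>)"
    by (rule sum.swap)
  also have "\<dots> = (\<Sum>l=1..g. shifted_sum \<tau> l * a n (- int l))"
  proof (rule sum.cong[OF refl])
    fix l assume l: "l \<in> {1..g}"
    have "shifted_sum \<tau> l = (\<Sum>j=g + 1..n + g + 1. a (g + 1) (int l - int j) * f j \<tau>)"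
      unfolding shifted_sum_def using l n by (intro sum.mono_neutral_left) (auto simp: a_below)
    then show "(\<Sum>j=g + 1..n + g + 1. a n (- int l) * a (g + 1) (int l - int j) * f j \<tau>) =
        shifted_sum \<tau> l * a n (- int l)"
      by (simp only: sum_distrib_right sum_distrib_left mult_ac)
  qed
  finally show ?thesis by (simp add: mult.commute add_ac)
qed

text \<open>Duality replaces the coefficients of the \<open>h l\<close> by those of
  \<open>f n\<close>. In the factor \<open>1 - l\<close>, the 1 gives minus the sum \<open>X\<close>
  of the product expansion, and the \<open>- l\<close> gives \<open>Y\<close>, the derivative sum
  without its term at \<open>- n\<close>; hence \<open>Y\<close> equals \<open>n\<close> times
  \<open>a (g + 1) n\<close>.\<close>

lemma numerator_nth_high:
  assumes n: "n > g" and \<tau>: "Im \<tau> > 0"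
  shows "fls_nth (numerator \<tau>) n =
    of_nat (n + 1) * a (g + 1) n + shifted_sum \<tau> n - f (g + 1) \<tau> * f n \<tau>"
proof -
  define X where "X = (\<Sum>l=- int g..int g + 1. a n l * a (g + 1) (- l))"
  define Y where "Y = (\<Sum>l=- int g..int g + 1. of_int l * a n l * a (g + 1) (- l))"
  define Z where "Z = (\<Sum>l=1..g. shifted_sum \<tau> l * a n (- int l))"
  have "(\<Sum>l\<in>{- int g..int g + 1} - {0}. (of_int (1 - l) * a (g + 1) (- l)) * b l n) =
      (\<Sum>l\<in>{- int g..int g + 1} - {0}. - (a n l * a (g + 1) (- l)) + of_int l * a n l * a (g + 1) (- l))"
    using n by (intro sum.cong refl) (auto simp: duality algebra_simps)
  also have "\<dots> = (\<Sum>l=- int g..int g + 1. - (a n l * a (g + 1) (- l)) + of_int l * a n l * a (g + 1) (- l))"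
    by (rule sum.mono_neutral_left) (auto simp: a_0)
  also have "\<dots> = - X + Y" unfolding X_def Y_def by (simp only: sum.distrib sum_negf)
  finally have 1: "(\<Sum>l\<in>{- int g..int g + 1} - {0}. (of_int (1 - l) * a (g + 1) (- l)) * b l n) = - X + Y" .
  have 2: "(\<Sum>l=1..g. shifted_sum \<tau> l * b (- int l) n) = - Z"
    unfolding Z_def using n by (simp add: duality sum_negf)
  have "0 = (\<Sum>i=- int n..int (g + 1). of_int i * a n i * a (g + 1) (- i))"
    using n by (intro derivative_duality[symmetric]) auto
  also have "\<dots> = (\<Sum>i\<in>insert (- int n) {- int g..int g + 1}. of_int i * a n i * a (g + 1) (- i))"
    using n by (intro sum.mono_neutral_right) (auto simp: a_gap)
  also have "\<dots> = of_int (- int n) * a n (- int n) * a (g + 1) (- (- int n)) + Y"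
    unfolding Y_def using n by (intro sum.insert) auto
  finally have Y: "Y = of_nat n * a (g + 1) n" using n by (simp add: a_lead)
  have "fls_nth (numerator \<tau>) n = - X + Y - Z" unfolding numerator_nth 1 2 by simp
  moreover have "f (g + 1) \<tau> * f n \<tau> = shifted_sum \<tau> n + a (g + 1) n + X + Z"
    unfolding X_def Z_def by (rule product_expansion[OF n \<tau>])
  ultimately show ?thesis unfolding Y by (simp add: algebra_simps)
qed

text \<open>\<open>f 0 = 1\<close> contributes \<open>a (g + 1) n\<close>, the indices from 1 to
  \<open>g\<close> contribute nothing, and the remaining ones run from \<open>g + 1\<close> to
  \<open>n + g + 1\<close>, an empty range for negative \<open>n\<close>.\<close>

lemma generating_series_times_nth:
  assumes \<tau>: "Im \<tau> > 0"
  shows "fls_nth (generating_series \<tau> * Abs_fls (a (g + 1))) n =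
    a (g + 1) n + (if n \<ge> 0 then shifted_sum \<tau> (nat n) else 0)"
proof -
  have "fls_nth (generating_series \<tau> * Abs_fls (a (g + 1))) n =
      (\<Sum>i=0..n - (- int (g + 1)). fls_nth (generating_series \<tau>) i * a (g + 1) (n - i))"
    by (subst fls_times_nth_lower_bounds[of 0 _ "- int (g + 1)"])
       (auto simp: a_below fls_nth_generating_series)
  also have "\<dots> = (\<Sum>i=0..n + int (g + 1). f (nat i) \<tau> * a (g + 1) (n - i))"
    by (intro sum.cong) (auto simp: fls_nth_generating_series)
  also have "\<dots> = (\<Sum>j\<in>{j. int j \<le> n + int (g + 1)}. f j \<tau> * a (g + 1) (n - int j))"
    by (rule sum.reindex_bij_witness[of _ int nat]) auto
  finally have eq: "fls_nth (generating_series \<tau> * Abs_fls (a (g + 1))) n =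
      (\<Sum>j\<in>{j. int j \<le> n + int (g + 1)}. f j \<tau> * a (g + 1) (n - int j))" .
  have fin: "finite {j. int j \<le> n + int (g + 1)}"
    by (rule finite_subset[of _ "{..nat (n + int (g + 1))}"]) auto
  show ?thesis
  proof (cases "n < - int (g + 1)")
    case True
    then show ?thesis unfolding eq by (simp add: a_below)
  next
    case False
    define J where "J = {j. g < j \<and> int j \<le> n + int (g + 1)}"
    have "(\<Sum>j\<in>{j. int j \<le> n + int (g + 1)}. f j \<tau> * a (g + 1) (n - int j)) =
        (\<Sum>j\<in>insert 0 J. f j \<tau> * a (g + 1) (n - int j))"
    proof (rule sum.mono_neutral_right[OF fin])
      show "\<forall>j\<in>{j. int j \<le> n + int (g + 1)} - insert 0 J. f j \<tau> * a (g + 1) (n - int j) = 0"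
      proof
        fix j assume "j \<in> {j. int j \<le> n + int (g + 1)} - insert 0 J"
        then have "1 \<le> j" "j \<le> g" by (auto simp: J_def)
        then show "f j \<tau> * a (g + 1) (n - int j) = 0" by (simp add: f_gap \<tau>)
      qed
    qed (use False in \<open>auto simp: J_def\<close>)
    also have "\<dots> = a (g + 1) n + (\<Sum>j\<in>J. f j \<tau> * a (g + 1) (n - int j))"
      using finite_subset[OF _ fin, of J] by (subst sum.insert) (auto simp: J_def f_0 \<tau>)
    also have "(\<Sum>j\<in>J. f j \<tau> * a (g + 1) (n - int j)) = (if n \<ge> 0 then shifted_sum \<tau> (nat n) else 0)"
    proof (cases "n \<ge> 0")
      case True
      then have "J = {g + 1..nat n + g + 1}" by (auto simp: J_def)
      then show ?thesis using True by (simp add: shifted_sum_def mult.commute)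
    next
      case False
      then have "J = {}" by (auto simp: J_def)
      then show ?thesis using False by simp
    qed
    finally show ?thesis unfolding eq .
  qed
qed

text \<open>Up to exponent \<open>g\<close> the derivative reduces the factor \<open>1 + n\<close>
  of the numerator to 1, and the values \<open>f 0 = 1\<close> and \<open>f n = 0\<close> account
  for the rest. Above \<open>g\<close> the product with \<open>f n\<close> is matched by
  \<open>numerator_nth_high\<close>.\<close>

lemma generating_series_identity:
  assumes \<tau>: "Im \<tau> > 0"
  shows "generating_series \<tau> * (Abs_fls (a (g + 1)) - fls_const (f (g + 1) \<tau>)) =
    numerator \<tau> - fls_X * fls_deriv (Abs_fls (a (g + 1)))"
proof (rule fls_eqI)
  fix n
  have lhs: "fls_nth (generating_series \<tau> * (Abs_fls (a (g + 1)) - fls_const (f (g + 1) \<tau>))) n =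
      a (g + 1) n + (if n \<ge> 0 then shifted_sum \<tau> (nat n) - f (nat n) \<tau> * f (g + 1) \<tau> else 0)"
    by (simp add: right_diff_distrib generating_series_times_nth[OF \<tau>, unfolded Suc_eq_plus1[symmetric]]
        fls_nth_generating_series)
  have rhs: "fls_nth (numerator \<tau> - fls_X * fls_deriv (Abs_fls (a (g + 1)))) n =
      fls_nth (numerator \<tau>) n - of_int n * a (g + 1) n"
    using fls_nth_a[of "g + 1"] by (simp add: fls_X_times_conv_shift)
  consider "n < 0" | "n = 0" | "1 \<le> n" "n \<le> int g" | "n > int g" by linarith
  then show "fls_nth (generating_series \<tau> * (Abs_fls (a (g + 1)) - fls_const (f (g + 1) \<tau>))) n =
      fls_nth (numerator \<tau> - fls_X * fls_deriv (Abs_fls (a (g + 1)))) n"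
    unfolding lhs rhs
  proof cases
    case 1
    then show "a (g + 1) n + (if n \<ge> 0 then shifted_sum \<tau> (nat n) - f (nat n) \<tau> * f (g + 1) \<tau> else 0) =
      fls_nth (numerator \<tau>) n - of_int n * a (g + 1) n"
      by (simp add: numerator_nth_low algebra_simps)
  next
    case 2
    have "shifted_sum \<tau> 0 = f (g + 1) \<tau>" using a_lead[of "g + 1"] by (simp add: shifted_sum_def)
    then show "a (g + 1) n + (if n \<ge> 0 then shifted_sum \<tau> (nat n) - f (nat n) \<tau> * f (g + 1) \<tau> else 0) =
      fls_nth (numerator \<tau>) n - of_int n * a (g + 1) n"
      using 2 by (simp add: numerator_nth_low f_0 \<tau>)
  next
    case 3
    then have "f (nat n) \<tau> = 0" by (intro f_gap \<tau>) auto
    with 3 show "a (g + 1) n + (if n \<ge> 0 then shifted_sum \<tau> (nat n) - f (nat n) \<tau> * f (g + 1) \<tau> else 0) =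
      fls_nth (numerator \<tau>) n - of_int n * a (g + 1) n"
      by (simp add: numerator_nth_low algebra_simps)
  next
    case 4
    then have "fls_nth (numerator \<tau>) n =
        of_nat (nat n + 1) * a (g + 1) n + shifted_sum \<tau> (nat n) - f (g + 1) \<tau> * f (nat n) \<tau>"
      using numerator_nth_high[of "nat n" \<tau>] \<tau> by simp
    with 4 show "a (g + 1) n + (if n \<ge> 0 then shifted_sum \<tau> (nat n) - f (nat n) \<tau> * f (g + 1) \<tau> else 0) =
      fls_nth (numerator \<tau>) n - of_int n * a (g + 1) n"
      by (simp add: algebra_simps)
  qed
qed

section \<open>From formal series to functions\<close>

lemma gen_rhs_eq_eval:
  fixes \<tau>1 \<tau>2
  defines "z \<equiv> nome 1 \<tau>2"
  assumes \<tau>2: "Im \<tau>2 > 0"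
  shows "gen_rhs g f a h \<tau>1 \<tau>2 =
    (eval_fls (numerator \<tau>1) z - z * eval_fls (fls_deriv (Abs_fls (a (g + 1)))) z) /
    (eval_fls (Abs_fls (a (g + 1))) z - f (g + 1) \<tau>1)"
proof -
  have f: "q_series 1 (f (g + 1)) (Abs_fls (a (g + 1)))" by (rule q_series_f) simp
  have "deriv (f (g + 1)) \<tau>2 = 2 * of_real pi * \<i> * (z * eval_fls (fls_deriv (Abs_fls (a (g + 1)))) z)"
    using DERIV_imp_deriv[OF q_series_has_field_derivative[OF f zero_less_one \<tau>2]] by (simp add: z_def)
  moreover have "f (g + 1) \<tau>2 = eval_fls (Abs_fls (a (g + 1))) z" "A_fun g f a h \<tau>1 \<tau>2 = eval_fls (numerator \<tau>1) z"
    using f q_series_A_fun[of \<tau>1] \<tau>2 by (simp_all add: q_series_def z_def)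
  ultimately show ?thesis by (simp add: gen_rhs_def diff_divide_distrib)
qed

lemma generating_series_sums:
  assumes \<tau>1: "Im \<tau>1 > 0"
  obtains \<rho> where "\<rho> > 0" "\<And>\<tau>2. Im \<tau>2 > 0 \<Longrightarrow> norm (nome 1 \<tau>2) < \<rho> \<Longrightarrow>
    f (g + 1) \<tau>2 \<noteq> f (g + 1) \<tau>1 \<and> (\<lambda>n. f n \<tau>1 * nome 1 \<tau>2 ^ n) sums gen_rhs g f a h \<tau>1 \<tau>2"
proof -
  define F where "F = Abs_fls (a (g + 1))"
  define D where "D = F - fls_const (f (g + 1) \<tau>1)"
  define G where "G = generating_series \<tau>1"
  define \<Phi> where "\<Phi> = (\<lambda>z. eval_fls F z - f (g + 1) \<tau>1)"
  define \<Psi> where "\<Psi> = (\<lambda>z. (eval_fls (numerator \<tau>1) z - z * eval_fls (fls_deriv F) z) / \<Phi> z)"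
  have f: "q_series 1 (f (g + 1)) F" unfolding F_def by (rule q_series_f) simp
  have rF: "fls_conv_radius F > 0" using f by (auto simp: q_series_def intro: less_le_trans[of 0 1])
  have rD: "fls_conv_radius (fls_deriv F) > 0" using rF by (rule less_le_trans) simp
  have rN: "fls_conv_radius (numerator \<tau>1) > 0"
    using q_series_A_fun[of \<tau>1] by (auto simp: q_series_def intro: less_le_trans[of 0 1])
  \<comment> \<open>Subtracting a constant does not touch the pole, so the formal denominator is
    invertible whatever the value at \<open>\<tau>1\<close>.\<close>
  have "fls_nth D (- int (g + 1)) = 1" using a_lead[of "g + 1"] fls_nth_a[of "g + 1"] by (simp add: D_def F_def)
  then have "D \<noteq> 0" by auto
  have \<Phi>: "\<Phi> has_laurent_expansion D"
    unfolding \<Phi>_def D_def by (intro laurent_expansion_intros rF)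
  have "\<Psi> has_laurent_expansion (numerator \<tau>1 - fls_X * fls_deriv F) / D"
    unfolding \<Psi>_def by (intro laurent_expansion_intros rN rD \<Phi>)
  also have "(numerator \<tau>1 - fls_X * fls_deriv F) / D = G"
    using generating_series_identity[OF \<tau>1] \<open>D \<noteq> 0\<close> by (simp add: D_def G_def F_def nonzero_divide_eq_eq)
  \<comment> \<open>A Laurent expansion includes a positive radius of convergence; this is what
    bounds the growth of \<open>f n \<tau>1\<close> in \<open>n\<close>.\<close>
  finally have rG: "fls_conv_radius G > 0" and ev: "eventually (\<lambda>z. eval_fls G z = \<Psi> z) (at 0)"
    by (auto simp: has_laurent_expansion_def)
  have "eventually (\<lambda>z. \<Phi> z \<noteq> 0) (at 0)"
    using has_laurent_expansion_nonzero_imp_eventually_nonzero[OF \<Phi> \<open>D \<noteq> 0\<close>] .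
  moreover have "eventually (\<lambda>z. z \<in> eball 0 (fls_conv_radius G) - {0}) (at 0)"
    using rG by (intro eventually_at_in_open) (auto simp: zero_ereal_def)
  ultimately have "eventually (\<lambda>z. \<Phi> z \<noteq> 0 \<and> eval_fls G z = \<Psi> z \<and> ereal (norm z) < fls_conv_radius G) (at 0)"
    using ev by eventually_elim auto
  then obtain \<rho> where \<rho>: "\<rho> > 0" "\<And>z. z \<noteq> 0 \<Longrightarrow> norm z < \<rho> \<Longrightarrow>
      \<Phi> z \<noteq> 0 \<and> eval_fls G z = \<Psi> z \<and> ereal (norm z) < fls_conv_radius G"
    unfolding eventually_at by auto
  show ?thesis
  proof (rule that[OF \<rho>(1)])
    fix \<tau>2 assume \<tau>2: "Im \<tau>2 > 0" and small: "norm (nome 1 \<tau>2) < \<rho>"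
    define z where "z = nome 1 \<tau>2"
    have z: "\<Phi> z \<noteq> 0" "eval_fls G z = \<Psi> z" "ereal (norm z) < fls_conv_radius G"
      using \<rho>(2)[of z] small by (auto simp: z_def)
    have "f (g + 1) \<tau>2 = eval_fls F z" using f \<tau>2 by (simp add: q_series_def z_def)
    then have ne: "f (g + 1) \<tau>2 \<noteq> f (g + 1) \<tau>1" using z(1) by (simp add: \<Phi>_def)
    have "(\<lambda>n. fps_nth (Abs_fps (\<lambda>n. f n \<tau>1)) n * z ^ n) sums eval_fps (Abs_fps (\<lambda>n. f n \<tau>1)) z"
      using z(3) by (intro sums_eval_fps) (simp add: G_def generating_series_def)
    also have "eval_fps (Abs_fps (\<lambda>n. f n \<tau>1)) z = eval_fls G z"
      using z(3) by (simp add: G_def generating_series_def eval_fps_to_fls)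
    also have "\<dots> = gen_rhs g f a h \<tau>1 \<tau>2"
      using gen_rhs_eq_eval[OF \<tau>2, of \<tau>1] z(2) by (simp add: \<Psi>_def \<Phi>_def z_def F_def)
    finally show "f (g + 1) \<tau>2 \<noteq> f (g + 1) \<tau>1 \<and> (\<lambda>n. f n \<tau>1 * nome 1 \<tau>2 ^ n) sums gen_rhs g f a h \<tau>1 \<tau>2"
      using ne by (simp add: z_def)
  qed
qed

lemma gen_rhs_meromorphic: "gen_rhs g f a h \<tau>1 meromorphic_on upper_half_plane"
proof -
  have f: "f (g + 1) holomorphic_on upper_half_plane"
    by (rule q_series_holomorphic[OF q_series_f zero_less_one]) simp
  have "deriv (f (g + 1)) holomorphic_on upper_half_plane"
    by (rule holomorphic_deriv[OF f open_upper_half_plane])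
  moreover have "A_fun g f a h \<tau>1 holomorphic_on upper_half_plane"
    by (rule q_series_holomorphic[OF q_series_A_fun zero_less_one])
  ultimately have "f (g + 1) meromorphic_on upper_half_plane"
    "deriv (f (g + 1)) meromorphic_on upper_half_plane" "A_fun g f a h \<tau>1 meromorphic_on upper_half_plane"
    using f by (simp_all add: analytic_on_open open_upper_half_plane analytic_on_imp_meromorphic_on)
  then show ?thesis
    unfolding gen_rhs_def[abs_def] by (intro meromorphic_intros)
qed

end

theorem theorem1p14:
  fixes N g :: nat and S :: "nat set"
    and f :: "nat \<Rightarrow> complex \<Rightarrow> complex" and a :: "nat \<Rightarrow> int \<Rightarrow> complex"
    and h :: "int \<Rightarrow> complex \<Rightarrow> complex" and b :: "int \<Rightarrow> int \<Rightarrow> complex"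
    and \<tau>1 :: complex
  assumes "N > 0" and "S \<subseteq> exact_divisors N"
    and "has_genus (modular_curve (Gamma_plus N S)) g"
    and "\<not> infinity_weierstrass_point (Gamma_plus N S) g"
    and "is_f_family (Gamma_plus N S) g f a"
    and "is_h_family (Gamma_plus N S) g h b"
    and "Im \<tau>1 > 0"
  shows "(\<exists>R>0. \<forall>\<tau>2. Im \<tau>2 > R \<longrightarrow>
            f (g + 1) \<tau>2 \<noteq> f (g + 1) \<tau>1 \<and>
            (\<lambda>n. f n \<tau>1 * exp (2 * of_real pi * \<i> * \<tau>2) ^ n) sums gen_rhs g f a h \<tau>1 \<tau>2)
       \<and> (\<lambda>\<tau>2. gen_rhs g f a h \<tau>1 \<tau>2) meromorphic_on {\<tau>2. Im \<tau>2 > 0}"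
proof
  interpret modular_families N g S f a h b by unfold_locales fact+
  obtain \<rho> where \<rho>: "\<rho> > 0" "\<And>\<tau>2. Im \<tau>2 > 0 \<Longrightarrow> norm (nome 1 \<tau>2) < \<rho> \<Longrightarrow>
      f (g + 1) \<tau>2 \<noteq> f (g + 1) \<tau>1 \<and> (\<lambda>n. f n \<tau>1 * nome 1 \<tau>2 ^ n) sums gen_rhs g f a h \<tau>1 \<tau>2"
    by (rule generating_series_sums[OF assms(7)]) (rule that)
  \<comment> \<open>The nome has norm below \<rho> exactly above height
    \<open>- ln \<rho> / (2 * pi)\<close>; the maximum with 1 keeps \<open>R\<close> positive when
    \<rho> exceeds 1.\<close>
  define R where "R = max 1 (- ln \<rho> / (2 * pi))"
  have nome: "nome 1 \<tau> = exp (2 * of_real pi * \<i> * \<tau>)" for \<tau> by (simp add: nome_def)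
  have "norm (nome 1 \<tau>2) < \<rho>" if "Im \<tau>2 > R" for \<tau>2
  proof -
    have "- ln \<rho> / (2 * pi) < Im \<tau>2" using that by (simp add: R_def)
    then have "- ln \<rho> / (2 * pi) * (2 * pi) < Im \<tau>2 * (2 * pi)" by (intro mult_strict_right_mono) auto
    then have "- 2 * pi * Im \<tau>2 < ln \<rho>" by (simp add: mult_ac)
    then have "exp (- 2 * pi * Im \<tau>2) < \<rho>" using \<rho>(1) by (metis exp_less_mono exp_ln)
    then show ?thesis by (simp add: norm_nome)
  qed
  moreover have "Im \<tau>2 > 0" if "Im \<tau>2 > R" for \<tau>2 using that by (simp add: R_def)
  ultimately have "\<forall>\<tau>2. Im \<tau>2 > R \<longrightarrow> f (g + 1) \<tau>2 \<noteq> f (g + 1) \<tau>1 \<and>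
      (\<lambda>n. f n \<tau>1 * nome 1 \<tau>2 ^ n) sums gen_rhs g f a h \<tau>1 \<tau>2"
    using \<rho>(2) by blast
  moreover have "R > 0" by (simp add: R_def)
  ultimately show "\<exists>R>0. \<forall>\<tau>2. Im \<tau>2 > R \<longrightarrow> f (g + 1) \<tau>2 \<noteq> f (g + 1) \<tau>1 \<and>
      (\<lambda>n. f n \<tau>1 * exp (2 * of_real pi * \<i> * \<tau>2) ^ n) sums gen_rhs g f a h \<tau>1 \<tau>2"
    unfolding nome by blast
  show "gen_rhs g f a h \<tau>1 meromorphic_on {\<tau>2. Im \<tau>2 > 0}"
    by (rule gen_rhs_meromorphic)
qed

end
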